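(* Let $X=X_2$ with $|X|=1$. The fifteen tree patterns with four leaves, each regarded as a one-element pattern set, fall into exactly five Wilf equivalence classes.
   Context: Binary trees are written as bracket expressions: a leaf is its label, and a tree whose root has left subtree $A$ and right subtree $B$ is written $(A,B)$. A tree with $l$ leaves is a planar binary rooted tree (single internal vertex label) with leaves labelled bijectively by $\{1,\dots,l\}$ so that, assigning to each internal vertex the minimum label of its descendant leaves, the left child of each internal vertex has a smaller assigned number than its right child; there are fifteen such trees with four leaves. A subtree of $T$ is a subtree $S$ rooted at an internal vertex of $T$ such that for every internal vertex of $S$ both its children in $T$ are in $S$; its leaves carry the assigned integers and relabelling them order-preservingly by $1,\dots,l$ gives the standardisation $\mathrm{st}(S)$; $T$ avoids $P$ if $P\neq\mathrm{st}(S)$ for every subtree $S$. Patterns are Wilf equivalent if for every $l$ the numbers of trees with $l$ leaves avoiding them coincide. *)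

theory Defs
  imports Main
begin

(* As X = X_2 is a single operation, internal vertices carry no label.
   Node A B is the bracket expression (A,B). *)
datatype ltree = Leaf nat | Node ltree ltree

fun leaves :: "ltree \<Rightarrow> nat list" where
  "leaves (Leaf a) = [a]"
| "leaves (Node l r) = leaves l @ leaves r"

(* The number assigned to the root: the minimum of the leaf labels below it. *)
fun min_label :: "ltree \<Rightarrow> nat" where
  "min_label (Leaf a) = a"
| "min_label (Node l r) = min (min_label l) (min_label r)"

fun locally_increasing :: "ltree \<Rightarrow> bool" where
  "locally_increasing (Leaf a) \<longleftrightarrow> True"
| "locally_increasing (Node l r) \<longleftrightarrow>
     min_label l < min_label r \<and> locally_increasing l \<and> locally_increasing r"

definition trees :: "nat \<Rightarrow> ltree set" where
  "trees n = {t. distinct (leaves t) \<and> set (leaves t) = {1..n} \<and> locally_increasing t}"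

(* Subtrees sharing the root of t.  At each vertex reached, either both children are kept,
   or the vertex becomes a leaf of the subtree, carrying the number assigned to it in t. *)
fun root_subtrees :: "ltree \<Rightarrow> ltree set" where
  "root_subtrees (Leaf a) = {Leaf a}"
| "root_subtrees (Node l r) =
     insert (Leaf (min_label (Node l r)))
       {Node s s' | s s'. s \<in> root_subtrees l \<and> s' \<in> root_subtrees r}"

(* Subtrees rooted at an internal vertex of t.  The one-vertex subtree is included;
   it can only match a one-leaf pattern. *)
fun subtrees :: "ltree \<Rightarrow> ltree set" where
  "subtrees (Leaf a) = {}"
| "subtrees (Node l r) = root_subtrees (Node l r) \<union> subtrees l \<union> subtrees r"

fun relabel :: "(nat \<Rightarrow> nat) \<Rightarrow> ltree \<Rightarrow> ltree" where
  "relabel f (Leaf a) = Leaf (f a)"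
| "relabel f (Node l r) = Node (relabel f l) (relabel f r)"

definition standardisation :: "ltree \<Rightarrow> ltree" where
  "standardisation s = relabel (\<lambda>a. card {b \<in> set (leaves s). b \<le> a}) s"

definition avoids :: "ltree \<Rightarrow> ltree \<Rightarrow> bool" where
  "avoids t p \<longleftrightarrow> (\<forall>s \<in> subtrees t. p \<noteq> standardisation s)"

definition avoiders :: "ltree set \<Rightarrow> nat \<Rightarrow> ltree set" where
  "avoiders P n = {t \<in> trees n. \<forall>p \<in> P. avoids t p}"

definition wilf_equivalent :: "ltree set \<Rightarrow> ltree set \<Rightarrow> bool" where
  "wilf_equivalent P Q \<longleftrightarrow> (\<forall>n. card (avoiders P n) = card (avoiders Q n))"

definition wilf_relation_on :: "ltree set set \<Rightarrow> (ltree set \<times> ltree set) set" where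
  "wilf_relation_on \<P> = {(P, Q). P \<in> \<P> \<and> Q \<in> \<P> \<and> wilf_equivalent P Q}"

definition singleton_patterns :: "nat \<Rightarrow> ltree set set" where
  "singleton_patterns n = {{p} | p. p \<in> trees n}"

end

(* A tree is a snoc-list of right subtrees hanging off its left spine, i.e. a plane increasing tree;
   a pattern then constrains a few neighbouring siblings and their last children.  Reversing all
   sibling lists, or complementing the relative order inside them, permutes the patterns, as do two
   further bijections seen by cutting every sibling list at its least element m into
   (before m, children of m, after m).  Iterating this cut turns trees into increasing ternary trees.
   Exchanging the first two parts is one bijection.  The other moves the last but one child x of m:
   (P, K x y) becomes (P x, K y), and an order condition on x and y, the last two children of m,
   becomes one on the last siblings of the first two parts.
   The resulting five classes are told apart by the numbers of avoiding trees with six leaves. *)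
theory Submission
  imports Defs "HOL-Library.Multiset" "HOL-Library.Infinite_Set"
begin

section \<open>Avoiding a pattern with four leaves\<close>

text \<open>The cut at the least label m helps because of what can be seen from the vertex that
  hangs m on the left spine. To its left lie P and whatever precedes P, to its right m with its
  children K, while Q lies above it. The sibling just before P, if there is one, carries a smaller
  number than all of P and m. So a descent ending at m can only start at the last sibling of P, and
  a nonempty P supplies it automatically. Conditions that force a descent at m, or that speak about
  descendants of m alone, therefore become conditions on P, m and K, and these can be permuted
  freely. A condition satisfied by an ascent into m would depend on the siblings outside P; such
  patterns are reached by reversal or complement, which act on whole sibling lists of the binary
  trees.\<close>

fun occ :: "(ltree \<Rightarrow> ltree \<Rightarrow> bool) \<Rightarrow> ltree \<Rightarrow> bool" where
  "occ Q (Leaf a) \<longleftrightarrow> False"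
| "occ Q (Node l r) \<longleftrightarrow> Q l r \<or> occ Q l \<or> occ Q r"

definition wf_tree :: "ltree \<Rightarrow> bool" where
  "wf_tree t \<longleftrightarrow> distinct (leaves t) \<and> locally_increasing t"

lemma wf_tree_Leaf [simp]: "wf_tree (Leaf a)"
  by (simp add: wf_tree_def)

lemma wf_tree_Node:
  "wf_tree (Node l r) \<longleftrightarrow> wf_tree l \<and> wf_tree r \<and>
     set (leaves l) \<inter> set (leaves r) = {} \<and> min_label l < min_label r"
  by (auto simp: wf_tree_def)

lemma min_label_in_leaves [simp]: "min_label t \<in> set (leaves t)"
  by (induction t) (auto simp: min_def)

lemma min_label_le: "x \<in> set (leaves t) \<Longrightarrow> min_label t \<le> x"
  by (induction t) (auto intro: min.coboundedI1 min.coboundedI2)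

lemma min_label_Node [simp]: "wf_tree (Node l r) \<Longrightarrow> min_label (Node l r) = min_label l"
  by (simp add: wf_tree_Node)

lemma min_label_neq: "set (leaves s) \<inter> set (leaves t) = {} \<Longrightarrow> min_label s \<noteq> min_label t"
  using min_label_in_leaves by (metis disjoint_iff)

lemma occ_cong:
  assumes "wf_tree t" "\<And>l r. wf_tree (Node l r) \<Longrightarrow> Q l r \<longleftrightarrow> Q' l r"
  shows "occ Q t \<longleftrightarrow> occ Q' t"
  using assms(1) by (induction t) (use assms(2) in \<open>auto simp: wf_tree_Node\<close>)

section \<open>Matching the shape of a pattern at a vertex\<close>

fun fits :: "ltree \<Rightarrow> ltree \<Rightarrow> bool" where
  "fits (Leaf a) t \<longleftrightarrow> True"
| "fits (Node p q) (Leaf a) \<longleftrightarrow> False"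
| "fits (Node p q) (Node l r) \<longleftrightarrow> fits p l \<and> fits q r"

text \<open>Like \<open>fits\<close>, this reads only the shape of its first argument. The second
  equation gives a junk value for shapes that do not fit.\<close>

fun cut :: "ltree \<Rightarrow> ltree \<Rightarrow> ltree" where
  "cut (Leaf a) t = Leaf (min_label t)"
| "cut (Node p q) (Leaf a) = Leaf a"
| "cut (Node p q) (Node l r) = Node (cut p l) (cut q r)"

lemma fits_relabel: "fits (relabel f p) t \<longleftrightarrow> fits p t"
  by (induction p t rule: fits.induct) auto

lemma cut_relabel: "cut (relabel f p) t = cut p t"
  by (induction p t rule: cut.induct) auto

lemma cut_in_root_subtrees: "fits p t \<Longrightarrow> cut p t \<in> root_subtrees t"
proof (induction p t rule: fits.induct)
  case (1 a t) then show ?case by (cases t) auto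
qed auto

lemma root_subtrees_fits: "s \<in> root_subtrees t \<Longrightarrow> fits s t \<and> cut s t = s"
  by (induction t arbitrary: s) auto

text \<open>Standardisation changes labels but not the shape, so the only candidate for a match at
  the root is the subtree cut out along the shape of \<open>p\<close>.\<close>

lemma ex_root_subtree_iff:
  "(\<exists>s \<in> root_subtrees t. p = standardisation s) \<longleftrightarrow> fits p t \<and> p = standardisation (cut p t)"
  (is "?L \<longleftrightarrow> ?R")
proof
  assume ?L
  then obtain s where s: "s \<in> root_subtrees t" "p = standardisation s" by blast
  with root_subtrees_fits[OF s(1)] show ?R
    unfolding standardisation_def by (metis cut_relabel fits_relabel)
qed (use cut_in_root_subtrees in blast)

text \<open>A match is rooted at an internal vertex, so the search through all subtrees becomes one
  local test per internal vertex.\<close>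

lemma avoids_iff_occ:
  "avoids t p \<longleftrightarrow> \<not> occ (\<lambda>l r. fits p (Node l r) \<and> p = standardisation (cut p (Node l r))) t"
proof (induction t)
  case (Leaf a)
  then show ?case by (simp add: avoids_def)
next
  case (Node l r)
  have "avoids (Node l r) p \<longleftrightarrow>
      \<not> (\<exists>s \<in> root_subtrees (Node l r). p = standardisation s) \<and> avoids l p \<and> avoids r p"
    unfolding avoids_def subtrees.simps by blast
  then show ?case
    unfolding ex_root_subtree_iff Node.IH occ.simps by blast
qed

(* The relation compares the numbers of the second, third and fourth leaf of the matched subtree;
   the first leaf is always the least. *)
fun at_left_comb :: "(nat \<Rightarrow> nat \<Rightarrow> nat \<Rightarrow> bool) \<Rightarrow> ltree \<Rightarrow> ltree \<Rightarrow> bool" where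
  "at_left_comb R (Node (Node w x) y) z \<longleftrightarrow> R (min_label x) (min_label y) (min_label z)"
| "at_left_comb R _ _ \<longleftrightarrow> False"

fun at_left_zigzag :: "(nat \<Rightarrow> nat \<Rightarrow> nat \<Rightarrow> bool) \<Rightarrow> ltree \<Rightarrow> ltree \<Rightarrow> bool" where
  "at_left_zigzag R (Node w (Node x y)) z \<longleftrightarrow> R (min_label x) (min_label y) (min_label z)"
| "at_left_zigzag R _ _ \<longleftrightarrow> False"

fun at_fork :: "(nat \<Rightarrow> nat \<Rightarrow> nat \<Rightarrow> bool) \<Rightarrow> ltree \<Rightarrow> ltree \<Rightarrow> bool" where
  "at_fork R (Node w x) (Node y z) \<longleftrightarrow> R (min_label x) (min_label y) (min_label z)"
| "at_fork R _ _ \<longleftrightarrow> False"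

fun at_right_zigzag :: "(nat \<Rightarrow> nat \<Rightarrow> nat \<Rightarrow> bool) \<Rightarrow> ltree \<Rightarrow> ltree \<Rightarrow> bool" where
  "at_right_zigzag R w (Node (Node x y) z) \<longleftrightarrow> R (min_label x) (min_label y) (min_label z)"
| "at_right_zigzag R _ _ \<longleftrightarrow> False"

fun at_right_comb :: "ltree \<Rightarrow> ltree \<Rightarrow> bool" where
  "at_right_comb w (Node x (Node y z)) \<longleftrightarrow> True"
| "at_right_comb _ _ \<longleftrightarrow> False"

section \<open>Order conditions of the fifteen patterns\<close>

definition rank :: "nat list \<Rightarrow> nat \<Rightarrow> nat" where
  "rank xs a = length (filter (\<lambda>b. b \<le> a) xs)"

text \<open>Counting in a list instead of a set lets the ranks in an explicit list of four labels be
  computed by rewriting.\<close>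

lemma standardisation_eq_rank:
  assumes "distinct (leaves s)"
  shows "standardisation s = relabel (rank (leaves s)) s"
proof -
  have "card {b \<in> set (leaves s). b \<le> a} = rank (leaves s) a" for a
    using assms unfolding rank_def by (metis distinct_card distinct_filter set_filter)
  then show ?thesis
    by (simp add: standardisation_def)
qed

lemma rank_mono: "a \<le> b \<Longrightarrow> rank xs a \<le> rank xs b"
  unfolding rank_def by (induction xs) auto

lemma rank_less_imp_less: "rank xs a < rank xs b \<Longrightarrow> a < b"
  using rank_mono[of b a xs] by linarith

text \<open>From ranks to order, monotonicity of \<open>rank\<close> suffices; from order to ranks,
  the count is computed. The equations have the form that simplification gives to literal ranks,
  hence \<open>Suc 0\<close> on the left and numerals on the right.\<close>

lemma rank_four_iff:
  assumes "distinct [w, x, y, z]" "w < x" "w < y" "w < z"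
  shows "(Suc 0 = rank [w, x, y, z] w \<and> rank [w, x, y, z] x = 2 \<and> rank [w, x, y, z] y = 3 \<and> rank [w, x, y, z] z = 4)
      \<longleftrightarrow> x < y \<and> y < z"
    and "(Suc 0 = rank [w, x, y, z] w \<and> rank [w, x, y, z] x = 2 \<and> rank [w, x, y, z] y = 4 \<and> rank [w, x, y, z] z = 3)
      \<longleftrightarrow> x < z \<and> z < y"
    and "(Suc 0 = rank [w, x, y, z] w \<and> rank [w, x, y, z] x = 3 \<and> rank [w, x, y, z] y = 2 \<and> rank [w, x, y, z] z = 4)
      \<longleftrightarrow> y < x \<and> x < z"
    and "(Suc 0 = rank [w, x, y, z] w \<and> rank [w, x, y, z] x = 3 \<and> rank [w, x, y, z] y = 4 \<and> rank [w, x, y, z] z = 2)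
      \<longleftrightarrow> z < x \<and> x < y"
    and "(Suc 0 = rank [w, x, y, z] w \<and> rank [w, x, y, z] x = 4 \<and> rank [w, x, y, z] y = 2 \<and> rank [w, x, y, z] z = 3)
      \<longleftrightarrow> y < z \<and> z < x"
    and "(Suc 0 = rank [w, x, y, z] w \<and> rank [w, x, y, z] x = 4 \<and> rank [w, x, y, z] y = 3 \<and> rank [w, x, y, z] z = 2)
      \<longleftrightarrow> z < y \<and> y < x"
proof -
  let ?r = "rank [w, x, y, z]"
  have less: "a < b" if "?r a < ?r b" for a b
    using that by (rule rank_less_imp_less)
  show "(Suc 0 = ?r w \<and> ?r x = 2 \<and> ?r y = 3 \<and> ?r z = 4)
      \<longleftrightarrow> x < y \<and> y < z"
    "(Suc 0 = ?r w \<and> ?r x = 2 \<and> ?r y = 4 \<and> ?r z = 3)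
      \<longleftrightarrow> x < z \<and> z < y"
    "(Suc 0 = ?r w \<and> ?r x = 3 \<and> ?r y = 2 \<and> ?r z = 4)
      \<longleftrightarrow> y < x \<and> x < z"
    "(Suc 0 = ?r w \<and> ?r x = 3 \<and> ?r y = 4 \<and> ?r z = 2)
      \<longleftrightarrow> z < x \<and> x < y"
    "(Suc 0 = ?r w \<and> ?r x = 4 \<and> ?r y = 2 \<and> ?r z = 3)
      \<longleftrightarrow> y < z \<and> z < x"
    "(Suc 0 = ?r w \<and> ?r x = 4 \<and> ?r y = 3 \<and> ?r z = 2)
      \<longleftrightarrow> z < y \<and> y < x"
    using assms less[of x y] less[of y x] less[of x z] less[of z x] less[of y z] less[of z y]
    by (auto simp: rank_def split: if_splits)
qed

text \<open>The equivalence for \<open>R\<close> may assume the inequalities that local increase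
  forces on this shape. On a left comb these say that \<open>w\<close> is least; the zigzags and the
  fork force more, so their conditions are shorter.\<close>

lemma avoids_left_comb_iff:
  assumes "wf_tree t"
    and "\<And>w x y z. distinct [w, x, y, z] \<Longrightarrow> w < x \<and> w < y \<and> w < z \<Longrightarrow>
      i = rank [w, x, y, z] w \<and> j = rank [w, x, y, z] x \<and> k = rank [w, x, y, z] y \<and>
        l = rank [w, x, y, z] z \<longleftrightarrow> R x y z"
  shows "avoids t (Node (Node (Node (Leaf i) (Leaf j)) (Leaf k)) (Leaf l)) \<longleftrightarrow>
    \<not> occ (at_left_comb R) t"
  unfolding avoids_iff_occ
proof (intro arg_cong[where f = Not] occ_cong[OF assms(1)])
  fix u v
  assume wf: "wf_tree (Node u v)"
  show "fits (Node (Node (Node (Leaf i) (Leaf j)) (Leaf k)) (Leaf l)) (Node u v) \<and>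
      Node (Node (Node (Leaf i) (Leaf j)) (Leaf k)) (Leaf l) =
        standardisation (cut (Node (Node (Node (Leaf i) (Leaf j)) (Leaf k)) (Leaf l)) (Node u v))
      \<longleftrightarrow> at_left_comb R u v"
  proof (cases "(R, u, v)" rule: at_left_comb.cases)
    case (1 R' w x y z)
    with wf show ?thesis
      using assms(2)[of "min_label w" "min_label x" "min_label y" "min_label z"]
      by (auto simp: wf_tree_Node min_label_neq Int_Un_distrib Int_Un_distrib2 standardisation_eq_rank)
  qed auto
qed

lemma avoids_left_zigzag_iff:
  assumes "wf_tree t"
    and "\<And>w x y z. distinct [w, x, y, z] \<Longrightarrow> w < x \<and> x < y \<and> w < z \<Longrightarrow>
      i = rank [w, x, y, z] w \<and> j = rank [w, x, y, z] x \<and> k = rank [w, x, y, z] y \<and>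
        l = rank [w, x, y, z] z \<longleftrightarrow> R x y z"
  shows "avoids t (Node (Node (Leaf i) (Node (Leaf j) (Leaf k))) (Leaf l)) \<longleftrightarrow>
    \<not> occ (at_left_zigzag R) t"
  unfolding avoids_iff_occ
proof (intro arg_cong[where f = Not] occ_cong[OF assms(1)])
  fix u v
  assume wf: "wf_tree (Node u v)"
  show "fits (Node (Node (Leaf i) (Node (Leaf j) (Leaf k))) (Leaf l)) (Node u v) \<and>
      Node (Node (Leaf i) (Node (Leaf j) (Leaf k))) (Leaf l) =
        standardisation (cut (Node (Node (Leaf i) (Node (Leaf j) (Leaf k))) (Leaf l)) (Node u v))
      \<longleftrightarrow> at_left_zigzag R u v"
  proof (cases "(R, u, v)" rule: at_left_zigzag.cases)
    case (1 R' w x y z)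
    with wf show ?thesis
      using assms(2)[of "min_label w" "min_label x" "min_label y" "min_label z"]
      by (auto simp: wf_tree_Node min_label_neq Int_Un_distrib Int_Un_distrib2 standardisation_eq_rank)
  qed auto
qed

lemma avoids_fork_iff:
  assumes "wf_tree t"
    and "\<And>w x y z. distinct [w, x, y, z] \<Longrightarrow> w < x \<and> w < y \<and> y < z \<Longrightarrow>
      i = rank [w, x, y, z] w \<and> j = rank [w, x, y, z] x \<and> k = rank [w, x, y, z] y \<and>
        l = rank [w, x, y, z] z \<longleftrightarrow> R x y z"
  shows "avoids t (Node (Node (Leaf i) (Leaf j)) (Node (Leaf k) (Leaf l))) \<longleftrightarrow>
    \<not> occ (at_fork R) t"
  unfolding avoids_iff_occ
proof (intro arg_cong[where f = Not] occ_cong[OF assms(1)])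
  fix u v
  assume wf: "wf_tree (Node u v)"
  show "fits (Node (Node (Leaf i) (Leaf j)) (Node (Leaf k) (Leaf l))) (Node u v) \<and>
      Node (Node (Leaf i) (Leaf j)) (Node (Leaf k) (Leaf l)) =
        standardisation (cut (Node (Node (Leaf i) (Leaf j)) (Node (Leaf k) (Leaf l))) (Node u v))
      \<longleftrightarrow> at_fork R u v"
  proof (cases "(R, u, v)" rule: at_fork.cases)
    case (1 R' w x y z)
    with wf show ?thesis
      using assms(2)[of "min_label w" "min_label x" "min_label y" "min_label z"]
      by (auto simp: wf_tree_Node min_label_neq Int_Un_distrib Int_Un_distrib2 standardisation_eq_rank)
  qed auto
qed

lemma avoids_right_zigzag_iff:
  assumes "wf_tree t"
    and "\<And>w x y z. distinct [w, x, y, z] \<Longrightarrow> w < x \<and> x < y \<and> x < z \<Longrightarrow>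
      i = rank [w, x, y, z] w \<and> j = rank [w, x, y, z] x \<and> k = rank [w, x, y, z] y \<and>
        l = rank [w, x, y, z] z \<longleftrightarrow> R x y z"
  shows "avoids t (Node (Leaf i) (Node (Node (Leaf j) (Leaf k)) (Leaf l))) \<longleftrightarrow>
    \<not> occ (at_right_zigzag R) t"
  unfolding avoids_iff_occ
proof (intro arg_cong[where f = Not] occ_cong[OF assms(1)])
  fix u v
  assume wf: "wf_tree (Node u v)"
  show "fits (Node (Leaf i) (Node (Node (Leaf j) (Leaf k)) (Leaf l))) (Node u v) \<and>
      Node (Leaf i) (Node (Node (Leaf j) (Leaf k)) (Leaf l)) =
        standardisation (cut (Node (Leaf i) (Node (Node (Leaf j) (Leaf k)) (Leaf l))) (Node u v))
      \<longleftrightarrow> at_right_zigzag R u v"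
  proof (cases "(R, u, v)" rule: at_right_zigzag.cases)
    case (1 R' w x y z)
    with wf show ?thesis
      using assms(2)[of "min_label w" "min_label x" "min_label y" "min_label z"]
      by (auto simp: wf_tree_Node min_label_neq Int_Un_distrib Int_Un_distrib2 standardisation_eq_rank)
  qed auto
qed

lemma avoids_left_comb_1234:
  "wf_tree t \<Longrightarrow> avoids t (Node (Node (Node (Leaf 1) (Leaf 2)) (Leaf 3)) (Leaf 4)) \<longleftrightarrow>
    \<not> occ (at_left_comb (\<lambda>x y z. x < y \<and> y < z)) t"
  by (rule avoids_left_comb_iff) (simp_all add: rank_four_iff)

lemma avoids_left_comb_1243:
  "wf_tree t \<Longrightarrow> avoids t (Node (Node (Node (Leaf 1) (Leaf 2)) (Leaf 4)) (Leaf 3)) \<longleftrightarrow>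
    \<not> occ (at_left_comb (\<lambda>x y z. x < z \<and> z < y)) t"
  by (rule avoids_left_comb_iff) (simp_all add: rank_four_iff)

lemma avoids_left_comb_1324:
  "wf_tree t \<Longrightarrow> avoids t (Node (Node (Node (Leaf 1) (Leaf 3)) (Leaf 2)) (Leaf 4)) \<longleftrightarrow>
    \<not> occ (at_left_comb (\<lambda>x y z. y < x \<and> x < z)) t"
  by (rule avoids_left_comb_iff) (simp_all add: rank_four_iff)

lemma avoids_left_comb_1342:
  "wf_tree t \<Longrightarrow> avoids t (Node (Node (Node (Leaf 1) (Leaf 3)) (Leaf 4)) (Leaf 2)) \<longleftrightarrow>
    \<not> occ (at_left_comb (\<lambda>x y z. z < x \<and> x < y)) t"
  by (rule avoids_left_comb_iff) (simp_all add: rank_four_iff)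

lemma avoids_left_comb_1423:
  "wf_tree t \<Longrightarrow> avoids t (Node (Node (Node (Leaf 1) (Leaf 4)) (Leaf 2)) (Leaf 3)) \<longleftrightarrow>
    \<not> occ (at_left_comb (\<lambda>x y z. y < z \<and> z < x)) t"
  by (rule avoids_left_comb_iff) (simp_all add: rank_four_iff)

lemma avoids_left_comb_1432:
  "wf_tree t \<Longrightarrow> avoids t (Node (Node (Node (Leaf 1) (Leaf 4)) (Leaf 3)) (Leaf 2)) \<longleftrightarrow>
    \<not> occ (at_left_comb (\<lambda>x y z. z < y \<and> y < x)) t"
  by (rule avoids_left_comb_iff) (simp_all add: rank_four_iff)

lemma avoids_left_zigzag_1234:
  "wf_tree t \<Longrightarrow> avoids t (Node (Node (Leaf 1) (Node (Leaf 2) (Leaf 3))) (Leaf 4)) \<longleftrightarrow>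
    \<not> occ (at_left_zigzag (\<lambda>x y z. y < z)) t"
  by (rule avoids_left_zigzag_iff) (simp_all add: rank_four_iff)

lemma avoids_left_zigzag_1243:
  "wf_tree t \<Longrightarrow> avoids t (Node (Node (Leaf 1) (Node (Leaf 2) (Leaf 4))) (Leaf 3)) \<longleftrightarrow>
    \<not> occ (at_left_zigzag (\<lambda>x y z. x < z \<and> z < y)) t"
  by (rule avoids_left_zigzag_iff) (simp_all add: rank_four_iff)

lemma avoids_left_zigzag_1342:
  "wf_tree t \<Longrightarrow> avoids t (Node (Node (Leaf 1) (Node (Leaf 3) (Leaf 4))) (Leaf 2)) \<longleftrightarrow>
    \<not> occ (at_left_zigzag (\<lambda>x y z. z < x)) t"
  by (rule avoids_left_zigzag_iff) (simp_all add: rank_four_iff)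

lemma avoids_fork_1234:
  "wf_tree t \<Longrightarrow> avoids t (Node (Node (Leaf 1) (Leaf 2)) (Node (Leaf 3) (Leaf 4))) \<longleftrightarrow>
    \<not> occ (at_fork (\<lambda>x y z. x < y)) t"
  by (rule avoids_fork_iff) (simp_all add: rank_four_iff)

lemma avoids_fork_1324:
  "wf_tree t \<Longrightarrow> avoids t (Node (Node (Leaf 1) (Leaf 3)) (Node (Leaf 2) (Leaf 4))) \<longleftrightarrow>
    \<not> occ (at_fork (\<lambda>x y z. y < x \<and> x < z)) t"
  by (rule avoids_fork_iff) (simp_all add: rank_four_iff)

lemma avoids_fork_1423:
  "wf_tree t \<Longrightarrow> avoids t (Node (Node (Leaf 1) (Leaf 4)) (Node (Leaf 2) (Leaf 3))) \<longleftrightarrow>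
    \<not> occ (at_fork (\<lambda>x y z. z < x)) t"
  by (rule avoids_fork_iff) (simp_all add: rank_four_iff)

lemma avoids_right_zigzag_1234:
  "wf_tree t \<Longrightarrow> avoids t (Node (Leaf 1) (Node (Node (Leaf 2) (Leaf 3)) (Leaf 4))) \<longleftrightarrow>
    \<not> occ (at_right_zigzag (\<lambda>x y z. y < z)) t"
  by (rule avoids_right_zigzag_iff) (simp_all add: rank_four_iff)

lemma avoids_right_zigzag_1243:
  "wf_tree t \<Longrightarrow> avoids t (Node (Leaf 1) (Node (Node (Leaf 2) (Leaf 4)) (Leaf 3))) \<longleftrightarrow>
    \<not> occ (at_right_zigzag (\<lambda>x y z. z < y)) t"
  by (rule avoids_right_zigzag_iff) (simp_all add: rank_four_iff)

text \<open>A right comb forces the whole order of its leaves, so nothing but the shape remains to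
  be tested.\<close>

lemma avoids_right_comb_1234:
  assumes "wf_tree t"
  shows "avoids t (Node (Leaf 1) (Node (Leaf 2) (Node (Leaf 3) (Leaf 4)))) \<longleftrightarrow> \<not> occ at_right_comb t"
  unfolding avoids_iff_occ
proof (intro arg_cong[where f = Not] occ_cong[OF assms(1)])
  fix u v
  assume wf: "wf_tree (Node u v)"
  let ?p = "Node (Leaf 1) (Node (Leaf 2) (Node (Leaf 3) (Leaf 4)))"
  show "fits ?p (Node u v) \<and> ?p = standardisation (cut ?p (Node u v)) \<longleftrightarrow> at_right_comb u v"
    using wf by (cases "(u, v)" rule: at_right_comb.cases)
      (auto simp: wf_tree_Node min_label_neq Int_Un_distrib Int_Un_distrib2 standardisation_eq_rank rank_def)
qed

section \<open>Trees as increasing ternary trees\<close>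

(* N P m K Q stands for the sibling list P, m, Q with least element m, where K lists the children
   of m; the end of the list is reached by following the last component. *)
datatype tern = E | N tern nat tern tern

fun labels :: "tern \<Rightarrow> nat multiset" where
  "labels E = {#}"
| "labels (N P m K Q) = add_mset m (labels P + labels K + labels Q)"

fun inc :: "tern \<Rightarrow> bool" where
  "inc E \<longleftrightarrow> True"
| "inc (N P m K Q) \<longleftrightarrow>
     (\<forall>x \<in># labels P + labels K + labels Q. m < x) \<and> inc P \<and> inc K \<and> inc Q"

(* graft t s hangs the siblings s off the left spine above t, so t already carries everything that
   comes before them. *)
fun graft :: "ltree \<Rightarrow> tern \<Rightarrow> ltree" where
  "graft t E = t"
| "graft t (N P m K Q) = graft (Node (graft t P) (graft (Leaf m) K)) Q"

text \<open>A new last sibling smaller than all others becomes the new cutting point, with the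
  entire old list before it; otherwise the old cutting point stays.\<close>

fun snoc :: "tern \<Rightarrow> nat \<Rightarrow> tern \<Rightarrow> tern" where
  "snoc E b s = N E b s E"
| "snoc (N P m K Q) b s = (if b < m then N (N P m K Q) b s E else N P m K (snoc Q b s))"

(* The values at E are junk. *)
fun last_label :: "tern \<Rightarrow> nat" where
  "last_label E = 0"
| "last_label (N P m K Q) = (if Q = E then m else last_label Q)"

fun last_kids :: "tern \<Rightarrow> tern" where
  "last_kids E = E"
| "last_kids (N P m K Q) = (if Q = E then K else last_kids Q)"

text \<open>If nothing follows the least label, it is itself the last sibling, and the list without
  it is the part before it, already cut.\<close>

fun but_last :: "tern \<Rightarrow> tern" where
  "but_last E = E"
| "but_last (N P m K Q) = (if Q = E then P else N P m K (but_last Q))"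

fun flatten :: "ltree \<Rightarrow> tern" where
  "flatten (Leaf a) = E"
| "flatten (Node l r) = snoc (flatten l) (min_label r) (flatten r)"

lemma snoc_neq_E [simp]: "snoc s b u \<noteq> E"
  by (cases s) auto

lemma labels_snoc [simp]: "labels (snoc s b u) = add_mset b (labels s + labels u)"
  by (induction s) auto

lemma but_last_snoc [simp]: "but_last (snoc s b u) = s"
  and last_label_snoc [simp]: "last_label (snoc s b u) = b"
  and last_kids_snoc [simp]: "last_kids (snoc s b u) = u"
  by (induction s) auto

text \<open>The order makes \<open>snoc\<close> take the right branch again: a cutting label that is
  last lies below the root of \<open>P\<close>, and a last label inside \<open>Q\<close> exceeds
  \<open>m\<close>.\<close>

lemma snoc_but_last:
  "inc s \<Longrightarrow> s \<noteq> E \<Longrightarrow> snoc (but_last s) (last_label s) (last_kids s) = s"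
proof (induction s)
  case (N P m K Q)
  show ?case
  proof (cases "Q = E")
    case True
    then show ?thesis using N.prems by (cases P) auto
  next
    case False
    then have "last_label Q \<in># labels Q"
    proof -
      have "labels Q = labels (snoc (but_last Q) (last_label Q) (last_kids Q))"
        using False N by simp
      then show ?thesis by simp
    qed
    then have "m < last_label Q" using N.prems by simp
    then show ?thesis using False N by simp
  qed
qed simp

lemma labels_eq_but_last:
  "inc s \<Longrightarrow> s \<noteq> E \<Longrightarrow>
    labels s = add_mset (last_label s) (labels (but_last s) + labels (last_kids s))"
  using snoc_but_last[of s] by (metis labels_snoc)

lemma inc_snoc:
  assumes "inc s" "inc u" "b \<notin># labels s" "\<forall>x \<in># labels u. b < x"
  shows "inc (snoc s b u)"
  using assms
proof (induction s)
  case (N P m K Q)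
  show ?case
  proof (cases "b < m")
    case True
    moreover have "x = m \<or> m < x" if "x \<in># labels (N P m K Q)" for x
      using that N.prems(1) by auto
    ultimately have "b < x" if "x \<in># labels (N P m K Q)" for x
      using that by fastforce
    then show ?thesis using True N.prems by auto
  next
    case False
    then have "m < b" using N.prems(3) by auto
    then have "m < x" if "x \<in># labels u" for x
      using that N.prems(4) by fastforce
    then show ?thesis using \<open>m < b\<close> N by auto
  qed
qed simp

text \<open>This is the link between the two views: the last sibling is what hangs to the right of
  the root.\<close>

lemma graft_snoc: "graft t (snoc s b u) = Node (graft t s) (graft (Leaf b) u)"
  by (induction s arbitrary: t) auto

lemma graft_but_last:
  "inc s \<Longrightarrow> s \<noteq> E \<Longrightarrow>
    graft t s = Node (graft t (but_last s)) (graft (Leaf (last_label s)) (last_kids s))"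
  using snoc_but_last[of s] by (metis graft_snoc)

lemma inc_but_last:
  "inc s \<Longrightarrow> inc (but_last s) \<and> inc (last_kids s) \<and> (\<forall>x \<in># labels (last_kids s). last_label s < x)"
proof (induction s)
  case (N P m K Q)
  have "labels (but_last Q) \<subseteq># labels Q" if "Q \<noteq> E"
    using labels_eq_but_last[of Q] N.prems that by simp
  then show ?case
    using N by (auto dest: mset_subset_eqD)
qed simp

lemma size_but_last:
  "s \<noteq> E \<Longrightarrow> size (but_last s) < size s"
  "s \<noteq> E \<Longrightarrow> size (last_kids s) < size s"
  by (induction s) auto

lemma mset_leaves_graft [simp]: "mset (leaves (graft t s)) = mset (leaves t) + labels s"
  by (induction s arbitrary: t) auto

lemma min_label_graft:
  "inc s \<Longrightarrow> \<forall>x \<in># labels s. min_label t < x \<Longrightarrow> min_label (graft t s) = min_label t"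
  by (induction s arbitrary: t) (auto simp: min_def)

lemma locally_increasing_graft:
  "inc s \<Longrightarrow> \<forall>x \<in># labels s. min_label t < x \<Longrightarrow> locally_increasing t \<Longrightarrow>
    locally_increasing (graft t s)"
  by (induction s arbitrary: t) (auto simp: min_label_graft min_def)

text \<open>The induction is on size, since splitting off the last sibling does not follow the
  recursion of the datatype.\<close>

lemma flatten_graft: "inc s \<Longrightarrow> flatten (graft (Leaf a) s) = s"
proof (induction s arbitrary: a rule: measure_induct_rule[where f = size])
  case (less s)
  show ?case
  proof (cases "s = E")
    case False
    then show ?thesis
      using less size_but_last[of s] inc_but_last[of s] graft_but_last[of s "Leaf a"] snoc_but_last[of s]
      by (simp add: min_label_graft)
  qed simp
qed

lemma flatten_wf_tree:
  assumes "wf_tree t"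
  shows "inc (flatten t)" "mset (leaves t) = add_mset (min_label t) (labels (flatten t))"
proof -
  have "inc (flatten t) \<and> mset (leaves t) = add_mset (min_label t) (labels (flatten t))"
    using assms
  proof (induction t)
    case (Node l r)
    then have wf: "wf_tree l" "wf_tree r" and disj: "set (leaves l) \<inter> set (leaves r) = {}"
      by (auto simp: wf_tree_Node)
    note l = Node.IH(1)[OF wf(1)] and r = Node.IH(2)[OF wf(2)]
    have "min_label r \<notin># labels (flatten l)"
    proof
      assume "min_label r \<in># labels (flatten l)"
      then have "min_label r \<in># mset (leaves l)" using l by simp
      then show False using disj min_label_in_leaves[of r] by (auto simp del: min_label_in_leaves)
    qed
    moreover have "min_label r < x" if "x \<in># labels (flatten r)" for x
    proof -
      have "x \<in># mset (leaves r)" using that r by simp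
      then have "min_label r \<le> x" using min_label_le by simp
      moreover have "count (mset (leaves r)) (min_label r) \<le> 1"
        using wf(2) by (simp add: wf_tree_def distinct_count_atmost_1)
      then have "min_label r \<notin># labels (flatten r)" using r by (simp add: not_in_iff)
      then have "x \<noteq> min_label r" using that by blast
      ultimately show ?thesis by simp
    qed
    ultimately show ?case
      using l r Node.prems by (auto simp: wf_tree_Node min_def intro!: inc_snoc)
  qed simp
  then show "inc (flatten t)" "mset (leaves t) = add_mset (min_label t) (labels (flatten t))"
    by auto
qed

lemma graft_flatten: "wf_tree t \<Longrightarrow> graft (Leaf (min_label t)) (flatten t) = t"
proof (induction t)
  case (Node l r)
  then show ?case
    unfolding flatten.simps graft_snoc by (subst min_label_Node) (auto simp: wf_tree_Node)
qed simp

section \<open>Trees with n leaves and ternary trees on the labels 2 to n\<close>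

definition terns :: "nat \<Rightarrow> tern set" where
  "terns n = {s. inc s \<and> labels s = mset_set {2..n}}"

lemma trees_iff: "t \<in> trees n \<longleftrightarrow> locally_increasing t \<and> mset (leaves t) = mset_set {1..n}"
proof -
  have "distinct (leaves t) \<and> set (leaves t) = {1..n}" if "mset (leaves t) = mset_set {1..n}"
  proof
    show "set (leaves t) = {1..n}"
      using arg_cong[OF that, of set_mset] by simp
    then show "distinct (leaves t)"
      by (simp add: distinct_count_atmost_1 that count_mset_set')
  qed
  moreover have "mset (leaves t) = mset_set {1..n}"
    if "distinct (leaves t)" "set (leaves t) = {1..n}"
    using mset_set_set[OF that(1)] that(2) by simp
  ultimately show ?thesis
    unfolding trees_def by blast
qed

lemma wf_tree_if_trees: "t \<in> trees n \<Longrightarrow> wf_tree t"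
  by (simp add: trees_def wf_tree_def)

text \<open>The label 1 sits at the leftmost leaf, because the smaller number is always on the left.
  It is the fixed foot of the left spine, and the ternary tree carries the other labels.\<close>

lemma bij_betw_graft:
  assumes "n \<ge> 1"
  shows "bij_betw (graft (Leaf 1)) (terns n) (trees n)"
proof (rule bij_betw_byWitness[where f' = flatten])
  have *: "mset_set {1..n} = add_mset 1 (mset_set {2..n})"
  proof -
    have "{1..n} = insert 1 {2..n}" using assms by auto
    then show ?thesis by simp
  qed
  have min: "min_label t = 1" if "t \<in> trees n" for t
  proof -
    have "set (leaves t) = {1..n}" using that by (simp add: trees_def)
    then show ?thesis
      using min_label_in_leaves[of t] min_label_le[of 1 t] assms by auto
  qed
  show "\<forall>s \<in> terns n. flatten (graft (Leaf 1) s) = s"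
    by (simp add: terns_def flatten_graft)
  show "\<forall>t \<in> trees n. graft (Leaf 1) (flatten t) = t"
    using graft_flatten min wf_tree_if_trees by metis
  show "graft (Leaf 1) ` terns n \<subseteq> trees n"
    using * by (auto simp: terns_def trees_iff intro!: locally_increasing_graft)
  show "flatten ` trees n \<subseteq> terns n"
  proof (rule image_subsetI)
    fix t assume t: "t \<in> trees n"
    then show "flatten t \<in> terns n"
      using flatten_wf_tree[OF wf_tree_if_trees[OF t]] min[OF t] *
      by (simp add: terns_def trees_iff)
  qed
qed

section \<open>Local conditions carried over to ternary trees\<close>

text \<open>Each label \<open>m\<close> stands for the internal vertex that hangs \<open>m\<close>
  on its left spine. \<open>Q\<close> hangs higher up and is invisible from there, so
  \<open>B\<close> does not take it.\<close>

fun bad :: "(tern \<Rightarrow> nat \<Rightarrow> tern \<Rightarrow> bool) \<Rightarrow> tern \<Rightarrow> bool" where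
  "bad B E \<longleftrightarrow> False"
| "bad B (N P m K Q) \<longleftrightarrow> B P m K \<or> bad B P \<or> bad B K \<or> bad B Q"

(* The last right subtree of t precedes s in its sibling list without being part of s.  As its
   number is smaller, it never completes a descent with an element of s. *)
definition below :: "ltree \<Rightarrow> tern \<Rightarrow> bool" where
  "below t s \<longleftrightarrow> locally_increasing t \<and>
     (\<forall>x \<in># labels s. min_label t < x \<and> (\<forall>l r. t = Node l r \<longrightarrow> min_label r < x))"

text \<open>Before entering \<open>Q\<close> the induction replaces \<open>t\<close> by a tree whose
  last right subtree has number \<open>m\<close>. Since \<open>m\<close> is least in the list,
  \<open>below\<close> survives this step. Inside \<open>K\<close> everything restarts from
  \<open>Leaf m\<close>.\<close>

lemma occ_graft:
  assumes "inc s" "below t s"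
    and "\<And>t P m K. inc (N P m K E) \<Longrightarrow> below t (N P m K E) \<Longrightarrow>
      R (graft t P) (graft (Leaf m) K) \<longleftrightarrow> B P m K"
  shows "occ R (graft t s) \<longleftrightarrow> occ R t \<or> bad B s"
  using assms(1,2)
proof (induction s arbitrary: t)
  case (N P m K Q)
  let ?t = "Node (graft t P) (graft (Leaf m) K)"
  have "locally_increasing (graft t P)" "locally_increasing (graft (Leaf m) K)"
    using N.prems by (auto simp: below_def intro!: locally_increasing_graft)
  then have "occ R (graft ?t Q) \<longleftrightarrow> occ R ?t \<or> bad B Q"
    using N.prems by (intro N.IH) (auto simp: below_def min_label_graft)
  moreover have "occ R (graft t P) \<longleftrightarrow> occ R t \<or> bad B P"
    using N.prems by (intro N.IH) (auto simp: below_def)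
  moreover have "occ R (graft (Leaf m) K) \<longleftrightarrow> bad B K"
    using N.prems N.IH(2)[of "Leaf m"] by (simp add: below_def)
  moreover have "R (graft t P) (graft (Leaf m) K) \<longleftrightarrow> B P m K"
    using N.prems by (intro assms(3)) (auto simp: below_def)
  ultimately show ?case by auto
qed simp

lemma occ_graft_Leaf:
  assumes "inc s" "\<forall>x \<in># labels s. a < x"
    and "\<And>t P m K. inc (N P m K E) \<Longrightarrow> below t (N P m K E) \<Longrightarrow>
      R (graft t P) (graft (Leaf m) K) \<longleftrightarrow> B P m K"
  shows "occ R (graft (Leaf a) s) \<longleftrightarrow> bad B s"
proof -
  have "occ R (graft (Leaf a) s) \<longleftrightarrow> occ R (Leaf a) \<or> bad B s"
    using assms by (intro occ_graft) (auto simp: below_def)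
  then show ?thesis by simp
qed

section \<open>Pattern occurrences in increasing ternary trees\<close>

fun last_left :: "tern \<Rightarrow> tern" where
  "last_left E = E"
| "last_left (N P m K Q) = (if Q = E then P else last_left Q)"

lemma last_label_in_labels: "s \<noteq> E \<Longrightarrow> last_label s \<in># labels s"
  by (induction s) auto

text \<open>Let \<open>N P m K E\<close> be the last node on the right spine. For nonempty
  \<open>P\<close> the sibling before \<open>m\<close> is the last one of \<open>P\<close>, which is
  larger; for empty \<open>P\<close> it is the preceding label on the spine, which is smaller, or
  there is none.\<close>

lemma last_descent_iff:
  "inc s \<Longrightarrow> but_last s \<noteq> E \<and> last_label s < last_label (but_last s) \<longleftrightarrow> last_left s \<noteq> E"
proof (induction s)
  case (N P m K Q)
  show ?case
  proof (cases "Q = E")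
    case True
    then show ?thesis using N.prems last_label_in_labels[of P] by auto
  next
    case False
    then have "m < last_label Q" using N.prems last_label_in_labels[of Q] by auto
    then show ?thesis
      using False N.IH(3) N.prems by (cases "but_last Q = E") auto
  qed
qed simp

lemma graft_lastE:
  assumes "inc s" "s \<noteq> E"
  obtains r where "graft t s = Node (graft t (but_last s)) r" "min_label r = last_label s"
    "locally_increasing r" "(\<exists>a. r = Leaf a) \<longleftrightarrow> last_kids s = E"
proof
  let ?r = "graft (Leaf (last_label s)) (last_kids s)"
  have lk: "inc (last_kids s)" "\<forall>x \<in># labels (last_kids s). last_label s < x"
    using inc_but_last[OF assms(1)] by auto
  show "graft t s = Node (graft t (but_last s)) ?r"
    using graft_but_last[OF assms] .
  show "min_label ?r = last_label s" "locally_increasing ?r"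
    using lk by (simp_all add: min_label_graft locally_increasing_graft)
  show "(\<exists>a. ?r = Leaf a) \<longleftrightarrow> last_kids s = E"
    using graft_but_last[OF lk(1)] by (cases "last_kids s = E") auto
qed

lemma at_left_comb_iff:
  "at_left_comb R l r \<longleftrightarrow>
    (\<exists>w x y. l = Node (Node w x) y \<and> R (min_label x) (min_label y) (min_label r))"
  by (cases "(R, l, r)" rule: at_left_comb.cases) auto

lemma at_left_zigzag_iff:
  "at_left_zigzag R l r \<longleftrightarrow>
    (\<exists>w x y. l = Node w (Node x y) \<and> R (min_label x) (min_label y) (min_label r))"
  by (cases "(R, l, r)" rule: at_left_zigzag.cases) auto

lemma at_fork_iff:
  "at_fork R l r \<longleftrightarrow>
    (\<exists>w x y z. l = Node w x \<and> r = Node y z \<and> R (min_label x) (min_label y) (min_label z))"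
  by (cases "(R, l, r)" rule: at_fork.cases) auto

lemma at_right_zigzag_iff:
  "at_right_zigzag R l r \<longleftrightarrow>
    (\<exists>x y z. r = Node (Node x y) z \<and> R (min_label x) (min_label y) (min_label z))"
  by (cases "(R, l, r)" rule: at_right_zigzag.cases) auto

lemma at_right_comb_iff:
  "at_right_comb l r \<longleftrightarrow> (\<exists>x y z. r = Node x (Node y z))"
  by (cases "(l, r)" rule: at_right_comb.cases) auto

lemma less_last_label: "inc (N P m K Q) \<Longrightarrow> P \<noteq> E \<Longrightarrow> m < last_label P"
  "inc (N P m K Q) \<Longrightarrow> K \<noteq> E \<Longrightarrow> m < last_label K"
  using last_label_in_labels[of P] last_label_in_labels[of K] by auto

text \<open>Here \<open>z\<close> is \<open>m\<close> and \<open>x\<close> is the number of the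
  sibling before it. The comparison holds when that sibling lies in \<open>P\<close> and fails
  outside by \<open>below\<close>, so only the existence of a child of it is left to ask. The value
  \<open>last_kids E = E\<close> covers an empty \<open>P\<close>.\<close>

lemma occ_left_zigzag_graft:
  assumes "inc s" "\<forall>x \<in># labels s. a < x"
  shows "occ (at_left_zigzag (\<lambda>x y z. z < x)) (graft (Leaf a) s) \<longleftrightarrow>
    bad (\<lambda>P m K. last_kids P \<noteq> E) s"
  using assms
proof (rule occ_graft_Leaf)
  fix t P m K
  assume inc: "inc (N P m K E)" and t: "below t (N P m K E)"
  then have m: "min_label (graft (Leaf m) K) = m"
    by (simp add: min_label_graft)
  show "at_left_zigzag (\<lambda>x y z. z < x) (graft t P) (graft (Leaf m) K) \<longleftrightarrow> last_kids P \<noteq> E"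
  proof (cases "P = E")
    case True
    then show ?thesis
      using t m by (auto simp: at_left_zigzag_iff below_def)
  next
    case False
    moreover have "inc P" using inc by simp
    ultimately obtain r where "graft t P = Node (graft t (but_last P)) r" "min_label r = last_label P"
      "locally_increasing r" "(\<exists>a. r = Leaf a) \<longleftrightarrow> last_kids P = E"
      using graft_lastE by metis
    with m less_last_label(1)[OF inc False] show ?thesis
      by (cases r) (auto simp: at_left_zigzag_iff)
  qed
qed

text \<open>The pattern is a double descent ending at \<open>m\<close>. Its second step places
  \<open>y\<close> in \<open>P\<close>, and its first step is a descent at the end of
  \<open>P\<close>. If \<open>P\<close> has one element, \<open>x\<close> comes from
  \<open>t\<close> and is too small.\<close>

lemma occ_left_comb_graft:
  assumes "inc s" "\<forall>x \<in># labels s. a < x"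
  shows "occ (at_left_comb (\<lambda>x y z. z < y \<and> y < x)) (graft (Leaf a) s) \<longleftrightarrow>
    bad (\<lambda>P m K. last_left P \<noteq> E) s"
  using assms
proof (rule occ_graft_Leaf)
  fix t P m K
  assume inc: "inc (N P m K E)" and t: "below t (N P m K E)"
  then have m: "min_label (graft (Leaf m) K) = m"
    by (simp add: min_label_graft)
  show "at_left_comb (\<lambda>x y z. z < y \<and> y < x) (graft t P) (graft (Leaf m) K) \<longleftrightarrow> last_left P \<noteq> E"
  proof (cases "P = E")
    case True
    then show ?thesis
      using t m by (auto simp: at_left_comb_iff below_def)
  next
    case False
    moreover have incP: "inc P" using inc by simp
    ultimately obtain r where r: "graft t P = Node (graft t (but_last P)) r" "min_label r = last_label P"
      using graft_lastE by metis
    have "last_label P \<in># labels P" using last_label_in_labels False by blast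
    then have "min_label x < last_label P" if "t = Node w x" for w x
      using t that by (auto simp: below_def)
    moreover have "\<exists>x. graft t (but_last P) = Node (graft t (but_last (but_last P))) x \<and>
        min_label x = last_label (but_last P)" if "but_last P \<noteq> E"
      using graft_lastE that inc_but_last[OF incP] by metis
    ultimately show ?thesis
      using r m less_last_label(1)[OF inc False] last_descent_iff[OF incP]
      by (cases "but_last P = E") (auto simp: at_left_comb_iff)
  qed
qed

text \<open>Neither labels nor earlier siblings enter: the last child of \<open>m\<close> must have
  a child of its own.\<close>

lemma occ_right_comb_graft:
  assumes "inc s" "\<forall>x \<in># labels s. a < x"
  shows "occ at_right_comb (graft (Leaf a) s) \<longleftrightarrow> bad (\<lambda>P m K. last_kids K \<noteq> E) s"
  using assms
proof (rule occ_graft_Leaf)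
  fix t P m K
  assume inc: "inc (N P m K E)"
  show "at_right_comb (graft t P) (graft (Leaf m) K) \<longleftrightarrow> last_kids K \<noteq> E"
  proof (cases "K = E")
    case False
    moreover have "inc K" using inc by simp
    ultimately obtain r where
      "graft (Leaf m) K = Node (graft (Leaf m) (but_last K)) r" "(\<exists>a. r = Leaf a) \<longleftrightarrow> last_kids K = E"
      using graft_lastE by metis
    then show ?thesis
      by (cases r) (auto simp: at_right_comb_iff)
  qed (simp add: at_right_comb_iff)
qed

text \<open>The numbers \<open>y\<close> and \<open>z\<close> belong to the last two children of
  \<open>m\<close>. Earlier siblings of \<open>m\<close> are out of sight, so \<open>R\<close> can
  be arbitrary.\<close>

lemma occ_right_zigzag_graft:
  assumes "inc s" "\<forall>x \<in># labels s. a < x"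
  shows "occ (at_right_zigzag (\<lambda>x y z. R y z)) (graft (Leaf a) s) \<longleftrightarrow>
    bad (\<lambda>P m K. but_last K \<noteq> E \<and> R (last_label (but_last K)) (last_label K)) s"
  using assms
proof (rule occ_graft_Leaf)
  fix t P m K
  assume inc: "inc (N P m K E)"
  show "at_right_zigzag (\<lambda>x y z. R y z) (graft t P) (graft (Leaf m) K) \<longleftrightarrow>
    but_last K \<noteq> E \<and> R (last_label (but_last K)) (last_label K)"
  proof (cases "K = E")
    case False
    moreover have incK: "inc K" using inc by simp
    ultimately obtain r where
      "graft (Leaf m) K = Node (graft (Leaf m) (but_last K)) r" "min_label r = last_label K"
      using graft_lastE by metis
    moreover have "\<exists>x. graft (Leaf m) (but_last K) = Node (graft (Leaf m) (but_last (but_last K))) x \<and>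
        min_label x = last_label (but_last K)" if "but_last K \<noteq> E"
      using graft_lastE that inc_but_last[OF incK] by metis
    ultimately show ?thesis
      by (cases "but_last K = E") (auto simp: at_right_zigzag_iff)
  qed (simp add: at_right_zigzag_iff)
qed

text \<open>Since \<open>m\<close> is below its last child, the hypothesis on \<open>R\<close> makes
  the sibling before \<open>m\<close> larger than \<open>m\<close>. This excludes a sibling from
  \<open>t\<close> and places it in \<open>P\<close>.\<close>

lemma occ_fork_graft:
  assumes "inc s" "\<forall>x \<in># labels s. a < x" and R: "\<And>x y z. R x y z \<Longrightarrow> y < z \<Longrightarrow> y < x"
  shows "occ (at_fork R) (graft (Leaf a) s) \<longleftrightarrow>
    bad (\<lambda>P m K. P \<noteq> E \<and> K \<noteq> E \<and> R (last_label P) m (last_label K)) s"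
  using assms(1,2)
proof (rule occ_graft_Leaf)
  fix t P m K
  assume inc: "inc (N P m K E)" and t: "below t (N P m K E)"
  show "at_fork R (graft t P) (graft (Leaf m) K) \<longleftrightarrow>
    P \<noteq> E \<and> K \<noteq> E \<and> R (last_label P) m (last_label K)"
  proof (cases "K = E")
    case False
    have incs: "inc K" "inc P" using inc by auto
    obtain r where r: "graft (Leaf m) K = Node (graft (Leaf m) (but_last K)) r" "min_label r = last_label K"
      using graft_lastE[OF incs(1) False] by metis
    have m: "min_label (graft (Leaf m) (but_last K)) = m"
      using inc False inc_but_last[OF incs(1)] labels_eq_but_last[OF incs(1)] by (simp add: min_label_graft)
    show ?thesis
    proof (cases "P = E")
      case True
      then show ?thesis
        using t r m less_last_label(2)[OF inc False] by (auto simp: at_fork_iff below_def dest!: R)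
    next
      case ne: False
      obtain u where "graft t P = Node (graft t (but_last P)) u" "min_label u = last_label P"
        using graft_lastE[OF incs(2) ne] by metis
      then show ?thesis
        using False ne r m by (auto simp: at_fork_iff)
    qed
  qed (simp add: at_fork_iff)
qed

section \<open>Enumeration of trees\<close>

text \<open>A largest label has nothing below it in an increasing tree, so it can only fill an empty
  position. A tree with k labels has 2k+1 of these.\<close>

fun insert_label :: "nat \<Rightarrow> tern \<Rightarrow> tern list" where
  "insert_label n E = [N E n E E]"
| "insert_label n (N P m K Q) =
     map (\<lambda>P'. N P' m K Q) (insert_label n P) @
     map (\<lambda>K'. N P m K' Q) (insert_label n K) @
     map (\<lambda>Q'. N P m K Q') (insert_label n Q)"

fun delete_label :: "nat \<Rightarrow> tern \<Rightarrow> tern" where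
  "delete_label n E = E"
| "delete_label n (N P m K Q) =
     (if m = n then E else N (delete_label n P) m (delete_label n K) (delete_label n Q))"

text \<open>The shift by one comes from the label 1, which stays at the base leaf: n labels, from 2
  to n+1, belong to trees with n+1 leaves.\<close>

fun tern_list :: "nat \<Rightarrow> tern list" where
  "tern_list 0 = [E]"
| "tern_list (Suc n) = concat (map (insert_label (Suc (Suc n))) (tern_list n))"

lemma delete_label_id: "n \<notin># labels s \<Longrightarrow> delete_label n s = s"
  by (induction s) auto

text \<open>That deletion recovers \<open>s\<close> shows later that insertions into different trees
  never coincide.\<close>

lemma insert_label_props:
  assumes "inc s" "\<forall>x \<in># labels s. x < n" "s' \<in> set (insert_label n s)"
  shows "labels s' = add_mset n (labels s) \<and> inc s' \<and> delete_label n s' = s"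
  using assms
proof (induction s arbitrary: s')
  case (N P m K Q)
  from N.prems have m: "m < n" and notin: "n \<notin># labels P" "n \<notin># labels K" "n \<notin># labels Q" by auto
  from N.prems(3) consider
      (P) P' where "P' \<in> set (insert_label n P)" "s' = N P' m K Q"
    | (K) K' where "K' \<in> set (insert_label n K)" "s' = N P m K' Q"
    | (Q) Q' where "Q' \<in> set (insert_label n Q)" "s' = N P m K Q'"
    by auto
  then show ?case
  proof cases
    case P
    then have "labels P' = add_mset n (labels P) \<and> inc P' \<and> delete_label n P' = P"
      using N.prems by (intro N.IH(1)) auto
    then show ?thesis using P(2) m notin N.prems(1) by (simp add: delete_label_id)
  next
    case K
    then have "labels K' = add_mset n (labels K) \<and> inc K' \<and> delete_label n K' = K"
      using N.prems by (intro N.IH(2)) auto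
    then show ?thesis using K(2) m notin N.prems(1) by (simp add: delete_label_id)
  next
    case Q
    then have "labels Q' = add_mset n (labels Q) \<and> inc Q' \<and> delete_label n Q' = Q"
      using N.prems by (intro N.IH(3)) auto
    then show ?thesis using Q(2) m notin N.prems(1) by (simp add: delete_label_id)
  qed
qed simp

lemma distinct_insert_label: "n \<notin># labels s \<Longrightarrow> distinct (insert_label n s)"
proof (induction s)
  case (N P m K Q)
  \<comment> \<open>Two of the three sublists could share a tree only if an insertion left its
    argument unchanged.\<close>
  have "s \<notin> set (insert_label n s)" for s
    by (induction s) auto
  then show ?case
    using N by (auto simp: distinct_map inj_on_def)
qed simp

lemma delete_label_props:
  assumes "inc s" "labels s = add_mset n M" "\<forall>x \<in># M. x < n"
  shows "inc (delete_label n s) \<and> labels (delete_label n s) = M \<and> s \<in> set (insert_label n (delete_label n s))"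
  using assms
proof (induction s arbitrary: M)
  case (N P m K Q)
  show ?case
  proof (cases "m = n")
    case True
    then have M: "M = labels P + labels K + labels Q" using N.prems(2) by simp
    have "M = {#}"
    proof (rule ccontr)
      assume "M \<noteq> {#}"
      then obtain x where "x \<in># M" by auto
      then have "n < x" "x < n" using N.prems True M by auto
      then show False by simp
    qed
    then have "labels P = {#}" "labels K = {#}" "labels Q = {#}" using M by auto
    then have "P = E" "K = E" "Q = E" by (cases P; cases K; cases Q; simp)+
    then show ?thesis using True \<open>M = {#}\<close> by simp
  next
    case False
    define L where "L = labels P + labels K + labels Q"
    have L: "add_mset m L = add_mset n M" using N.prems(2) by (simp add: L_def)
    then obtain L' where L': "L = add_mset n L'" "M = add_mset m L'"
      using False by (metis add_eq_conv_ex)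
    have lt: "x < n" if "x \<in># L'" for x using N.prems(3) L' that by simp
    have "n \<in># L" using L' by simp
    then consider (P) "n \<in># labels P" | (K) "n \<in># labels K" | (Q) "n \<in># labels Q"
      unfolding L_def by auto
    then show ?thesis
    proof cases
      case P
      then obtain A where A: "labels P = add_mset n A" by (meson multi_member_split)
      then have "L' = A + labels K + labels Q" using L' L_def by simp
      then have "n \<notin># labels K" "n \<notin># labels Q" "\<forall>x \<in># A. x < n" using lt by auto
      moreover from this have "inc (delete_label n P) \<and> labels (delete_label n P) = A \<and>
          P \<in> set (insert_label n (delete_label n P))"
        using N.prems(1) A by (intro N.IH(1)) auto
      ultimately show ?thesis
        using N.prems(1) False A unfolding L'(2) \<open>L' = _\<close> by (simp add: delete_label_id)
    next
      case K
      then obtain A where A: "labels K = add_mset n A" by (meson multi_member_split)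
      then have "L' = labels P + A + labels Q" using L' L_def by simp
      then have "n \<notin># labels P" "n \<notin># labels Q" "\<forall>x \<in># A. x < n" using lt by auto
      moreover from this have "inc (delete_label n K) \<and> labels (delete_label n K) = A \<and>
          K \<in> set (insert_label n (delete_label n K))"
        using N.prems(1) A by (intro N.IH(2)) auto
      ultimately show ?thesis
        using N.prems(1) False A unfolding L'(2) \<open>L' = _\<close> by (simp add: delete_label_id)
    next
      case Q
      then obtain A where A: "labels Q = add_mset n A" by (meson multi_member_split)
      then have "L' = labels P + labels K + A" using L' L_def by simp
      then have "n \<notin># labels P" "n \<notin># labels K" "\<forall>x \<in># A. x < n" using lt by auto
      moreover from this have "inc (delete_label n Q) \<and> labels (delete_label n Q) = A \<and>
          Q \<in> set (insert_label n (delete_label n Q))"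
        using N.prems(1) A by (intro N.IH(3)) auto
      ultimately show ?thesis
        using N.prems(1) False A unfolding L'(2) \<open>L' = _\<close> by (simp add: delete_label_id)
    qed
  qed
qed simp

lemma tern_list: "set (tern_list n) = terns (Suc n) \<and> distinct (tern_list n)"
proof (induction n)
  case 0
  have "terns (Suc 0) = {E}"
  proof (intro set_eqI iffI)
    fix s assume "s \<in> terns (Suc 0)"
    then have "labels s = {#}" by (simp add: terns_def)
    then show "s \<in> {E}" by (cases s) simp_all
  qed (simp add: terns_def)
  then show ?case by simp
next
  case (Suc n)
  let ?k = "Suc (Suc n)"
  have ms: "mset_set {2..?k} = add_mset ?k (mset_set {2..Suc n})"
  proof -
    have "{2..?k} = insert ?k {2..Suc n}" by auto
    then show ?thesis by simp
  qed
  have prem: "inc s" "\<forall>x \<in># labels s. x < ?k" if "s \<in> terns (Suc n)" for s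
    using that by (simp_all add: terns_def)
  have "set (tern_list (Suc n)) = terns ?k"
  proof (intro set_eqI iffI)
    fix s assume "s \<in> set (tern_list (Suc n))"
    then obtain u where u: "u \<in> terns (Suc n)" "s \<in> set (insert_label ?k u)"
      using Suc unfolding tern_list.simps set_concat set_map by blast
    show "s \<in> terns ?k"
      using insert_label_props[OF prem[OF u(1)] u(2)] u(1) ms by (simp add: terns_def)
  next
    fix s assume "s \<in> terns ?k"
    then have "inc s" "labels s = add_mset ?k (mset_set {2..Suc n})"
      using ms by (simp_all add: terns_def)
    then have "delete_label ?k s \<in> terns (Suc n)" "s \<in> set (insert_label ?k (delete_label ?k s))"
      using delete_label_props[of s ?k "mset_set {2..Suc n}"] by (simp_all add: terns_def)
    then show "s \<in> set (tern_list (Suc n))"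
      using Suc unfolding tern_list.simps set_concat set_map by blast
  qed
  moreover have "distinct (tern_list (Suc n))"
  proof -
    have disj: "s = u" if "s \<in> terns (Suc n)" "u \<in> terns (Suc n)"
      "x \<in> set (insert_label ?k s)" "x \<in> set (insert_label ?k u)" for s u x
      using insert_label_props[OF prem[OF that(1)] that(3)] insert_label_props[OF prem[OF that(2)] that(4)]
      by simp
    have "x \<in> set (insert_label ?k s)" if "x = hd (insert_label ?k s)" for s x
    proof -
      have "insert_label ?k s \<noteq> []" by (induction s) auto
      then show ?thesis using that by simp
    qed
    then have "inj_on (insert_label ?k) (terns (Suc n))"
      using disj by (metis inj_onI)
    then have "distinct (map (insert_label ?k) (tern_list n))"
      using Suc by (simp add: distinct_map)
    moreover have "distinct (insert_label ?k s)" if "s \<in> terns (Suc n)" for s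
      using prem[OF that] by (intro distinct_insert_label) auto
    moreover have "set (insert_label ?k s) \<inter> set (insert_label ?k u) = {}"
      if "s \<in> terns (Suc n)" "u \<in> terns (Suc n)" "insert_label ?k s \<noteq> insert_label ?k u" for s u
      using disj that by blast
    ultimately show ?thesis
      unfolding tern_list.simps by (intro distinct_concat) (use Suc in auto)
  qed
  ultimately show ?case by blast
qed

lemma trees_eq_tern_list: "trees (Suc n) = graft (Leaf 1) ` set (tern_list n)"
  using bij_betw_imp_surj_on[OF bij_betw_graft[of "Suc n"]] tern_list by simp

lemma trees_0: "trees 0 = {}"
proof -
  have "leaves t \<noteq> []" for t by (induction t) auto
  then show ?thesis by (auto simp: trees_def)
qed

lemma finite_trees: "finite (trees n)"
  by (cases n) (simp_all add: trees_0 trees_eq_tern_list)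

lemma card_trees_filter:
  "card {t \<in> trees (Suc n). A t} = length (filter A (map (graft (Leaf 1)) (tern_list n)))"
proof -
  have "distinct (map (graft (Leaf 1)) (tern_list n))"
    using bij_betw_imp_inj_on[OF bij_betw_graft[of "Suc n"]] tern_list by (simp add: distinct_map)
  then have "length (filter A (map (graft (Leaf 1)) (tern_list n))) =
      card (set (filter A (map (graft (Leaf 1)) (tern_list n))))"
    by (metis distinct_card distinct_filter)
  also have "set (filter A (map (graft (Leaf 1)) (tern_list n))) = {t \<in> trees (Suc n). A t}"
    by (auto simp: trees_eq_tern_list)
  finally show ?thesis by simp
qed

section \<open>Criteria for Wilf equivalence\<close>

text \<open>An injective self-map of the finite set \<open>trees n\<close> is onto, so no inverse
  has to be constructed.\<close>

lemma wilf_equivalentI: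
  assumes "\<And>n. inj_on f (trees n)" "\<And>n. f ` trees n \<subseteq> trees n"
    and "\<And>n t. t \<in> trees n \<Longrightarrow> avoids t p \<longleftrightarrow> avoids (f t) q"
  shows "wilf_equivalent {p} {q}"
  unfolding wilf_equivalent_def
proof
  fix n
  have "f ` trees n = trees n"
    using assms(1,2) finite_trees by (simp add: endo_inj_surj)
  moreover have "avoiders {q} n \<subseteq> f ` avoiders {p} n" if "f ` trees n = trees n"
  proof
    fix u assume "u \<in> avoiders {q} n"
    then have "u \<in> f ` trees n" "avoids u q" using that by (auto simp: avoiders_def)
    then show "u \<in> f ` avoiders {p} n" using assms(3) by (auto simp: avoiders_def)
  qed
  moreover have "f ` avoiders {p} n \<subseteq> avoiders {q} n"
    using assms(2)[of n] assms(3) by (auto simp: avoiders_def)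
  ultimately have "f ` avoiders {p} n = avoiders {q} n" by blast
  moreover have "inj_on f (avoiders {p} n)"
    using assms(1)[of n] by (rule inj_on_subset) (auto simp: avoiders_def)
  ultimately show "card (avoiders {p} n) = card (avoiders {q} n)"
    by (metis card_image)
qed

lemma wilf_equivalentI_tern:
  assumes h: "\<And>n s. s \<in> terns n \<Longrightarrow> h s \<in> terns n" "\<And>n. inj_on h (terns n)"
    and p: "\<And>t. wf_tree t \<Longrightarrow> avoids t p \<longleftrightarrow> \<not> occ R t"
    and q: "\<And>t. wf_tree t \<Longrightarrow> avoids t q \<longleftrightarrow> \<not> occ S t"
    and RS: "\<And>n s. s \<in> terns n \<Longrightarrow> occ R (graft (Leaf 1) s) \<longleftrightarrow> occ S (graft (Leaf 1) (h s))"
  shows "wilf_equivalent {p} {q}"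
proof (rule wilf_equivalentI)
  let ?G = "graft (Leaf 1)"
  let ?f = "\<lambda>t. ?G (h (flatten t))"
  have f: "\<exists>s \<in> terns n. t = ?G s \<and> ?f t = ?G (h s)" if "t \<in> trees n" for t n
  proof -
    have "n \<ge> 1" using that trees_0 by (cases n) auto
    from bij_betw_graft[OF this] that obtain s where s: "s \<in> terns n" "t = ?G s"
      by (auto simp: bij_betw_def)
    then have "flatten t = s" by (simp add: terns_def flatten_graft)
    then show ?thesis using s by blast
  qed
  fix n
  show "inj_on ?f (trees n)"
  proof (rule inj_onI)
    fix t u assume tu: "t \<in> trees n" "u \<in> trees n" "?f t = ?f u"
    then have n: "n \<ge> 1" using trees_0 by (cases n) auto
    obtain s v where sv: "s \<in> terns n" "v \<in> terns n" "t = ?G s" "u = ?G v"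
      and "?G (h s) = ?G (h v)"
      using f[OF tu(1)] f[OF tu(2)] tu(3) by metis
    then have "h s = h v"
      using h(1) bij_betw_graft[OF n] by (meson bij_betw_imp_inj_on inj_onD)
    then have "s = v"
      using h(2) sv by (meson inj_onD)
    then show "t = u" using sv by simp
  qed
  show "?f ` trees n \<subseteq> trees n"
  proof (rule image_subsetI)
    fix t assume t: "t \<in> trees n"
    then have "n \<ge> 1" using trees_0 by (cases n) auto
    then show "?f t \<in> trees n"
      using f[OF t] h(1) bij_betw_graft by (metis bij_betwE)
  qed
  fix t assume t: "t \<in> trees n"
  with f obtain s where s: "s \<in> terns n" "t = ?G s" "?f t = ?G (h s)" by blast
  have "occ R (?G s) \<longleftrightarrow> occ S (?G (h s))" using RS s(1) by blast
  then have "occ R t \<longleftrightarrow> occ S (?f t)"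
    using s(2,3) by metis
  then show "avoids t p \<longleftrightarrow> avoids (?f t) q"
    using p q wf_tree_if_trees t \<open>?f ` trees n \<subseteq> trees n\<close> by (metis image_subset_iff)
qed

section \<open>Bijections of increasing ternary trees\<close>

fun swap :: "tern \<Rightarrow> tern" where
  "swap E = E"
| "swap (N P m K Q) = N (swap K) m (swap P) (swap Q)"

lemma swap_swap [simp]: "swap (swap s) = s"
  by (induction s) auto

lemma swap_eq_E_iff [simp]: "swap s = E \<longleftrightarrow> s = E"
  by (cases s) auto

lemma labels_swap [simp]: "labels (swap s) = labels s"
  by (induction s) (auto simp: ac_simps)

lemma inc_swap: "inc s \<Longrightarrow> inc (swap s)"
  by (induction s) auto

text \<open>Along the right spine the labels stay and the two parts hanging at each of them trade
  places. Applied to the last label, this turns conditions on its left part into conditions on its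
  children.\<close>

lemma last_label_swap [simp]: "last_label (swap s) = last_label s"
  and last_kids_swap [simp]: "last_kids (swap s) = swap (last_left s)"
  and last_left_swap [simp]: "last_left (swap s) = swap (last_kids s)"
  by (induction s) auto

lemma bad_swap:
  assumes "\<And>P m K. B' (swap K) m (swap P) \<longleftrightarrow> B P m K"
  shows "bad B' (swap s) \<longleftrightarrow> bad B s"
  using assms by (induction s) auto

lemma inj_swap: "inj_on swap A"
  by (metis inj_onI swap_swap)

lemma bad_cong:
  assumes "inc s" "\<And>P m K. inc (N P m K E) \<Longrightarrow> B P m K \<longleftrightarrow> B' P m K"
  shows "bad B s \<longleftrightarrow> bad B' s"
  using assms(1)
proof (induction s)
  case (N P m K Q)
  then show ?case using assms(2)[of P m K] by auto
qed simp

(* (P, []) stays, (P, [y]) becomes ([], P y) and (P, K x y) becomes (P x, K y). *)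
definition move :: "tern \<Rightarrow> tern \<Rightarrow> tern \<times> tern" where
  "move P K =
     (if K = E then (P, E)
      else if but_last K = E then (E, snoc P (last_label K) (last_kids K))
      else (snoc P (last_label (but_last K)) (last_kids (but_last K)),
            snoc (but_last (but_last K)) (last_label K) (last_kids K)))"

lemma size_snoc [simp]: "size (snoc s b u) = Suc (size s + size u)"
  by (induction s) auto

lemma size_eq_but_last: "s \<noteq> E \<Longrightarrow> size s = Suc (size (but_last s) + size (last_kids s))"
  by (induction s) auto

lemma size_move: "move P K = (P', K') \<Longrightarrow> size P' + size K' = size P + size K"
  using size_eq_but_last[of K] size_eq_but_last[of "but_last K"]
  by (auto simp: move_def split: if_splits)

text \<open>The move is made at the root and the recursion then enters the moved parts, so
  termination needs that a move keeps the total size.\<close>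

function rearrange :: "tern \<Rightarrow> tern" where
  "rearrange E = E"
| "rearrange (N P m K Q) =
     N (rearrange (fst (move P K))) m (rearrange (snd (move P K))) (rearrange Q)"
  by pat_completeness auto
termination
proof (relation "measure size", goal_cases)
  case (2 P m K Q)
  show ?case using size_move[of P K] by (cases "move P K") auto
next
  case (3 P m K Q)
  show ?case using size_move[of P K] by (cases "move P K") auto
qed auto

lemma labels_move:
  assumes "inc P" "inc K" "move P K = (P', K')"
  shows "labels P' + labels K' = labels P + labels K"
proof -
  have "inc (but_last K)" using assms inc_but_last by blast
  then show ?thesis
    using assms labels_eq_but_last[of K] labels_eq_but_last[of "but_last K"]
    by (auto simp: move_def ac_simps split: if_splits)
qed

lemma move_eq_E:
  assumes "move P K = (P', K')"
  shows "K' = E \<longleftrightarrow> K = E" "K \<noteq> E \<Longrightarrow> P' = E \<longleftrightarrow> but_last K = E"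
  using assms by (auto simp: move_def split: if_splits)

text \<open>The three cases can be told apart in the image: the second part is empty only in the
  first case, and otherwise the first part is empty only in the second. Within a case, removing last
  siblings returns the pieces.\<close>

lemma move_inject:
  assumes "inc K" "inc K2" "move P K = (P', K')" "move P2 K2 = (P', K')"
  shows "P = P2" "K = K2"
proof -
  have i: "inc (but_last K)" "inc (but_last K2)" using assms inc_but_last by blast+
  have d: "snoc s b u = snoc s' b' u' \<longleftrightarrow> s = s' \<and> b = b' \<and> u = u'" for s b u s' b' u'
    by (metis but_last_snoc last_kids_snoc last_label_snoc)
  have "P = P2 \<and> K = K2"
  proof (cases "K = E")
    case True
    then show ?thesis using assms(3,4) by (auto simp: move_def split: if_splits)
  next
    case False
    then have "K2 \<noteq> E" using move_eq_E(1)[OF assms(3)] move_eq_E(1)[OF assms(4)] by simp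
    have *: "but_last K = E \<longleftrightarrow> but_last K2 = E"
      using move_eq_E(2)[OF assms(3)] move_eq_E(2)[OF assms(4)] False \<open>K2 \<noteq> E\<close> by simp
    note K = snoc_but_last[OF assms(1) False] snoc_but_last[OF assms(2) \<open>K2 \<noteq> E\<close>]
    show ?thesis
    proof (cases "but_last K = E")
      case True
      then have "P = P2" "last_label K = last_label K2" "last_kids K = last_kids K2"
        using assms(3,4) * False \<open>K2 \<noteq> E\<close> d by (auto simp: move_def)
      then show ?thesis using K True * by metis
    next
      case ne: False
      then have ne2: "but_last K2 \<noteq> E" using * by simp
      have eqs: "P = P2" "last_label (but_last K) = last_label (but_last K2)"
        "last_kids (but_last K) = last_kids (but_last K2)"
        "but_last (but_last K) = but_last (but_last K2)"
        "last_label K = last_label K2" "last_kids K = last_kids K2"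
        using assms(3,4) ne ne2 False \<open>K2 \<noteq> E\<close> d by (auto simp: move_def)
      then have "but_last K = but_last K2"
        using snoc_but_last[OF i(1) ne] snoc_but_last[OF i(2) ne2] by metis
      then show ?thesis using K eqs by metis
    qed
  qed
  then show "P = P2" "K = K2" by auto
qed

text \<open>A condition on child lists alone does not depend on how the siblings are cut, so a new
  sibling adds just its own contribution.\<close>

lemma bad_snoc:
  "bad (\<lambda>P m K. C K) (snoc s b u) \<longleftrightarrow> C u \<or> bad (\<lambda>P m K. C K) s \<or> bad (\<lambda>P m K. C K) u"
  by (induction s) auto

text \<open>Distinct labels ensure that a sibling appended to another list does not meet its own
  label there, as \<open>inc_snoc\<close> requires.\<close>

definition ok :: "tern \<Rightarrow> bool" where
  "ok s \<longleftrightarrow> inc s \<and> (\<forall>x. count (labels s) x \<le> 1)"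

lemma ok_NodeD:
  assumes "ok (N P m K Q)"
  shows "ok P" "ok K" "ok Q" "x \<in># labels P \<Longrightarrow> x \<notin># labels K"
proof -
  have inc: "inc P" "inc K" "inc Q" using assms by (auto simp: ok_def)
  have c: "count (labels P) x + count (labels K) x + count (labels Q) x \<le> 1" for x
  proof -
    have "count (labels (N P m K Q)) x \<le> 1" using assms by (simp only: ok_def)
    then show ?thesis by (auto split: if_splits)
  qed
  have "count (labels P) x \<le> 1 \<and> count (labels K) x \<le> 1 \<and> count (labels Q) x \<le> 1" for x
    using c[of x] by linarith
  then show "ok P" "ok K" "ok Q"
    using inc by (auto simp: ok_def)
  show "x \<in># labels P \<Longrightarrow> x \<notin># labels K"
  proof
    assume "x \<in># labels P" "x \<in># labels K"
    then have "count (labels P) x \<ge> 1" "count (labels K) x \<ge> 1" by simp_all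
    then show False using c[of x] by linarith
  qed
qed

lemma ok_move:
  assumes "ok (N P m K Q)" "move P K = (P', K')"
  shows "ok (N P' m K' Q)"
proof -
  note ok = ok_NodeD[OF assms(1)]
  have incs: "inc P" "inc K" "inc Q" using ok by (auto simp: ok_def)
  note lab = labels_move[OF incs(1,2) assms(2)]
  have "labels (N P' m K' Q) = labels (N P m K Q)"
    using lab by simp
  moreover have "inc P' \<and> inc K'"
  proof (cases "K = E")
    case True
    then show ?thesis using assms(2) incs by (simp add: move_def)
  next
    case False
    let ?K1 = "but_last K"
    note K = labels_eq_but_last[OF incs(2) False] inc_but_last[OF incs(2)]
    show ?thesis
    proof (cases "?K1 = E")
      case True
      have "last_label K \<notin># labels P" using ok(4)[of "last_label K"] K(1) by auto
      then show ?thesis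
        using assms(2) False True K incs by (auto simp: move_def intro!: inc_snoc)
    next
      case ne: False
      have "inc ?K1" using K(2) by blast
      note K1 = labels_eq_but_last[OF this ne] inc_but_last[OF this]
      have "last_label ?K1 \<notin># labels P" using ok(4)[of "last_label ?K1"] K(1) K1(1) by auto
      moreover have "last_label K \<notin># labels (but_last ?K1)"
      proof
        assume "last_label K \<in># labels (but_last ?K1)"
        then have "count (labels (but_last ?K1)) (last_label K) \<ge> 1" by simp
        then have "count (labels K) (last_label K) > 1" using K(1) K1(1) by simp
        then show False using ok(2) by (metis leD ok_def)
      qed
      moreover have "P' = snoc P (last_label ?K1) (last_kids ?K1)"
        "K' = snoc (but_last ?K1) (last_label K) (last_kids K)"
        using assms(2) False ne by (simp_all add: move_def)
      ultimately show ?thesis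
        using K(2) K1(2) incs by (simp add: inc_snoc)
    qed
  qed
  moreover have "m < x" if "x \<in># labels P' + labels K'" for x
  proof -
    have "x \<in># labels P + labels K" using that lab by simp
    then show ?thesis using assms(1) by (auto simp: ok_def)
  qed
  ultimately show ?thesis
    using assms(1) unfolding ok_def by auto
qed

lemma rearrange_eq_E_iff [simp]: "rearrange s = E \<longleftrightarrow> s = E"
  by (cases s) auto

text \<open>Labels on the right spine are never moved, so a condition on last labels reads the same
  before and after the recursive calls.\<close>

lemma last_label_rearrange [simp]: "last_label (rearrange s) = last_label s"
  by (induction s rule: rearrange.induct) auto

lemma rearrange_props:
  "ok s \<Longrightarrow> inc (rearrange s) \<and> labels (rearrange s) = labels s"
proof (induction s rule: rearrange.induct)
  case (2 P m K Q)
  obtain P' K' where mv: "move P K = (P', K')" by (cases "move P K")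
  have "ok (N P' m K' Q)" using ok_move[OF 2(4) mv] .
  note ok = ok_NodeD[OF this] this
  have "labels P' + labels K' = labels P + labels K"
    using labels_move[OF _ _ mv] ok_NodeD[OF 2(4)] by (simp add: ok_def)
  moreover have "inc (rearrange P') \<and> labels (rearrange P') = labels P'"
    "inc (rearrange K') \<and> labels (rearrange K') = labels K'"
    "inc (rearrange Q) \<and> labels (rearrange Q) = labels Q"
    using 2(1-3) mv ok by auto
  ultimately show ?case
    using mv ok(5) by (simp add: ok_def)
qed simp

lemma rearrange_inject:
  "ok s \<Longrightarrow> ok u \<Longrightarrow> rearrange s = rearrange u \<Longrightarrow> s = u"
proof (induction s arbitrary: u rule: rearrange.induct)
  case 1
  then show ?case by (metis rearrange.simps(1) rearrange_eq_E_iff)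
next
  case (2 P m K Q)
  then obtain P2 K2 Q2 where u: "u = N P2 m K2 Q2"
    by (cases u) auto
  obtain P' K' where mv: "move P K = (P', K')" by (cases "move P K")
  obtain P2' K2' where mv2: "move P2 K2 = (P2', K2')" by (cases "move P2 K2")
  have eqs: "rearrange P' = rearrange P2'" "rearrange K' = rearrange K2'" "rearrange Q = rearrange Q2"
    using 2(6) u mv mv2 by auto
  note ok = ok_NodeD[OF ok_move[OF 2(4) mv]]
  note ok2 = ok_NodeD[OF ok_move[OF 2(5)[unfolded u] mv2]]
  have "P' = P2'" "K' = K2'" "Q = Q2"
    using 2(1)[of P2'] 2(2)[of K2'] 2(3)[of Q2] mv eqs ok ok2 by auto
  moreover have "inc K" "inc K2"
    using ok_NodeD[OF 2(4)] ok_NodeD[OF 2(5)[unfolded u]] by (auto simp: ok_def)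
  ultimately show ?case
    using move_inject mv mv2 u by metis
qed

text \<open>Moved siblings keep their own child lists, so the tests below the current vertex are the
  same for both sides. At the vertex itself, the last two labels of \<open>K\<close> have become the
  last labels of the two new parts. With fewer than two children one new part is empty and both
  tests fail.\<close>

lemma bad_rearrange:
  fixes R :: "nat \<Rightarrow> nat \<Rightarrow> bool"
  defines "C \<equiv> \<lambda>K. but_last K \<noteq> E \<and> R (last_label (but_last K)) (last_label K)"
  assumes "ok s"
  shows "bad (\<lambda>P m K. P \<noteq> E \<and> K \<noteq> E \<and> R (last_label P) (last_label K)) (rearrange s) \<longleftrightarrow>
    bad (\<lambda>P m K. C K) s"
  using assms(2)
proof (induction s rule: rearrange.induct)
  case (2 P m K Q)
  obtain P' K' where mv: "move P K = (P', K')" by (cases "move P K")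
  note ok = ok_NodeD[OF ok_move[OF 2(4) mv]]
  let ?b = "bad (\<lambda>P m K. C K)"
  have C: "C L \<longleftrightarrow> but_last L \<noteq> E \<and> R (last_label (but_last L)) (last_label L)" for L
    by (simp add: C_def)
  have incK: "inc K" using ok_NodeD[OF 2(4)] by (simp add: ok_def)
  have split: "?b L \<longleftrightarrow> C (last_kids L) \<or> ?b (but_last L) \<or> ?b (last_kids L)" if "inc L" "L \<noteq> E" for L
    using bad_snoc[of C "but_last L" "last_label L" "last_kids L"] snoc_but_last[OF that] by simp
  have "(P' \<noteq> E \<and> K' \<noteq> E \<and> R (last_label P') (last_label K')) \<or> ?b P' \<or> ?b K' \<longleftrightarrow> C K \<or> ?b P \<or> ?b K"
  proof (cases "K = E")
    case True
    then show ?thesis using mv by (auto simp: move_def C)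
  next
    case False
    show ?thesis
    proof (cases "but_last K = E")
      case True
      then show ?thesis
        using mv False split[OF incK False] C[of K] by (auto simp: move_def bad_snoc[of C])
    next
      case ne: False
      have "inc (but_last K)" using inc_but_last[OF incK] by blast
      note s = split[OF incK False] split[OF this ne]
      have "P' = snoc P (last_label (but_last K)) (last_kids (but_last K))"
        "K' = snoc (but_last (but_last K)) (last_label K) (last_kids K)"
        using mv False ne by (simp_all add: move_def)
      then show ?thesis
        using s ne C[of K] by (auto simp: bad_snoc[of C])
    qed
  qed
  then show ?case
    using 2(1-3) mv ok by auto
qed simp

lemma ok_if_terns: "s \<in> terns n \<Longrightarrow> ok s"
  by (simp add: terns_def ok_def count_mset_set')

lemma terns_less: "s \<in> terns n \<Longrightarrow> \<forall>x \<in># labels s. 1 < x"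
  by (simp add: terns_def)

lemma terns_inc: "s \<in> terns n \<Longrightarrow> inc s"
  by (simp add: terns_def)

section \<open>Equivalences from the two ternary bijections\<close>

abbreviation left_comb :: "nat \<Rightarrow> nat \<Rightarrow> nat \<Rightarrow> ltree" where
  "left_comb a b c \<equiv> Node (Node (Node (Leaf 1) (Leaf a)) (Leaf b)) (Leaf c)"

abbreviation left_zigzag :: "nat \<Rightarrow> nat \<Rightarrow> nat \<Rightarrow> ltree" where
  "left_zigzag a b c \<equiv> Node (Node (Leaf 1) (Node (Leaf a) (Leaf b))) (Leaf c)"

abbreviation fork :: "nat \<Rightarrow> nat \<Rightarrow> nat \<Rightarrow> ltree" where
  "fork a b c \<equiv> Node (Node (Leaf 1) (Leaf a)) (Node (Leaf b) (Leaf c))"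

abbreviation right_zigzag :: "nat \<Rightarrow> nat \<Rightarrow> nat \<Rightarrow> ltree" where
  "right_zigzag a b c \<equiv> Node (Leaf 1) (Node (Node (Leaf a) (Leaf b)) (Leaf c))"

abbreviation right_comb :: "nat \<Rightarrow> nat \<Rightarrow> nat \<Rightarrow> ltree" where
  "right_comb a b c \<equiv> Node (Leaf 1) (Node (Leaf a) (Node (Leaf b) (Leaf c)))"

text \<open>Expressing the descent by a nonempty part gives it a form on which \<open>swap\<close>
  acts.\<close>

lemma bad_right_zigzag_descent:
  assumes "inc s"
  shows "bad (\<lambda>P m K. but_last K \<noteq> E \<and> last_label K < last_label (but_last K)) s \<longleftrightarrow>
    bad (\<lambda>P m K. last_left K \<noteq> E) s"
  using assms by (rule bad_cong) (use last_descent_iff in auto)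

lemma terns_swap: "s \<in> terns n \<Longrightarrow> swap s \<in> terns n"
  by (simp add: terns_def inc_swap)

lemma terns_rearrange: "s \<in> terns n \<Longrightarrow> rearrange s \<in> terns n"
  using rearrange_props[OF ok_if_terns, of s n] by (simp add: terns_def)

lemma wilf_left_comb_right_comb: "wilf_equivalent {left_comb 4 3 2} {right_comb 2 3 4}"
proof (rule wilf_equivalentI_tern[OF terns_swap inj_swap avoids_left_comb_1432 avoids_right_comb_1234])
  fix n s assume s: "s \<in> terns n"
  note s' = terns_swap[OF s]
  show "occ (at_left_comb (\<lambda>x y z. z < y \<and> y < x)) (graft (Leaf 1) s) \<longleftrightarrow>
      occ at_right_comb (graft (Leaf 1) (swap s))"
    unfolding occ_left_comb_graft[OF terns_inc[OF s] terns_less[OF s]]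
      occ_right_comb_graft[OF terns_inc[OF s'] terns_less[OF s']]
    by (rule bad_swap[symmetric]) simp
qed

lemma wilf_left_zigzag_right_zigzag: "wilf_equivalent {left_zigzag 3 4 2} {right_zigzag 2 4 3}"
proof (rule wilf_equivalentI_tern[OF terns_swap inj_swap avoids_left_zigzag_1342 avoids_right_zigzag_1243])
  fix n s assume s: "s \<in> terns n"
  note s' = terns_swap[OF s]
  show "occ (at_left_zigzag (\<lambda>x y z. z < x)) (graft (Leaf 1) s) \<longleftrightarrow>
      occ (at_right_zigzag (\<lambda>x y z. z < y)) (graft (Leaf 1) (swap s))"
    unfolding occ_left_zigzag_graft[OF terns_inc[OF s] terns_less[OF s]]
      occ_right_zigzag_graft[OF terns_inc[OF s'] terns_less[OF s']] bad_right_zigzag_descent[OF terns_inc[OF s']]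
    by (rule bad_swap[symmetric]) simp
qed

text \<open>Exchanging the first two parts exchanges their last labels, which reverses the
  comparison of \<open>x\<close> with \<open>z\<close>; both exceed \<open>m\<close> anyway.\<close>

lemma wilf_fork_fork: "wilf_equivalent {fork 3 2 4} {fork 4 2 3}"
proof (rule wilf_equivalentI_tern[OF terns_swap inj_swap avoids_fork_1324 avoids_fork_1423])
  fix n s assume s: "s \<in> terns n"
  note s' = terns_swap[OF s]
  show "occ (at_fork (\<lambda>x y z. y < x \<and> x < z)) (graft (Leaf 1) s) \<longleftrightarrow>
      occ (at_fork (\<lambda>x y z. z < x)) (graft (Leaf 1) (swap s))"
    apply (subst occ_fork_graft[OF terns_inc[OF s] terns_less[OF s]], simp)
    apply (subst occ_fork_graft[OF terns_inc[OF s'] terns_less[OF s']], simp)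
    \<comment> \<open>This \<open>B'\<close> is the condition of the first fork with the roles of
      \<open>P\<close> and \<open>K\<close> exchanged; its comparison with \<open>m\<close> is
      automatic and is dropped by the next step.\<close>
    apply (subst bad_swap[symmetric, where B' = "\<lambda>P m K. P \<noteq> E \<and> K \<noteq> E \<and> m < last_label K \<and> last_label K < last_label P"], force)
    apply (rule bad_cong[OF terns_inc[OF s']])
    using less_last_label(2) by blast
qed

lemma wilf_right_zigzag_fork: "wilf_equivalent {right_zigzag 2 4 3} {fork 4 2 3}"
proof (rule wilf_equivalentI_tern[OF terns_rearrange _ avoids_right_zigzag_1243 avoids_fork_1423])
  show "inj_on rearrange (terns n)" for n
    using rearrange_inject ok_if_terns by (auto simp: inj_on_def)
  fix n s assume s: "s \<in> terns n"
  note s' = terns_rearrange[OF s]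
  show "occ (at_right_zigzag (\<lambda>x y z. z < y)) (graft (Leaf 1) s) \<longleftrightarrow>
      occ (at_fork (\<lambda>x y z. z < x)) (graft (Leaf 1) (rearrange s))"
    apply (subst occ_right_zigzag_graft[OF terns_inc[OF s] terns_less[OF s]])
    apply (subst occ_fork_graft[OF terns_inc[OF s'] terns_less[OF s']], simp)
    by (rule bad_rearrange[OF ok_if_terns[OF s], symmetric])
qed

lemma wilf_right_zigzag_fork': "wilf_equivalent {right_zigzag 2 3 4} {fork 3 2 4}"
proof (rule wilf_equivalentI_tern[OF terns_rearrange _ avoids_right_zigzag_1234 avoids_fork_1324])
  show "inj_on rearrange (terns n)" for n
    using rearrange_inject ok_if_terns by (auto simp: inj_on_def)
  fix n s assume s: "s \<in> terns n"
  note s' = terns_rearrange[OF s]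
  show "occ (at_right_zigzag (\<lambda>x y z. y < z)) (graft (Leaf 1) s) \<longleftrightarrow>
      occ (at_fork (\<lambda>x y z. y < x \<and> x < z)) (graft (Leaf 1) (rearrange s))"
    apply (subst occ_right_zigzag_graft[OF terns_inc[OF s] terns_less[OF s]])
    apply (subst occ_fork_graft[OF terns_inc[OF s'] terns_less[OF s']], simp)
    apply (subst bad_rearrange[OF ok_if_terns[OF s], symmetric])
    apply (rule bad_cong[OF terns_inc[OF s']])
    using less_last_label(1) by blast
qed

section \<open>Bijections permuting the subtrees along left spines\<close>

text \<open>The limbs are the sibling list before any cutting; reversal and complement treat it as a
  whole, so blocks of neighbours remain visible.\<close>

fun limbs :: "ltree \<Rightarrow> ltree list" where
  "limbs (Leaf a) = []"
| "limbs (Node l r) = limbs l @ [r]"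

fun base :: "ltree \<Rightarrow> nat" where
  "base (Leaf a) = a"
| "base (Node l r) = base l"

definition spine :: "nat \<Rightarrow> ltree list \<Rightarrow> ltree" where
  "spine a ts = foldl Node (Leaf a) ts"

lemma spine_Nil [simp]: "spine a [] = Leaf a"
  and spine_snoc [simp]: "spine a (ts @ [t]) = Node (spine a ts) t"
  by (simp_all add: spine_def)

lemma spine_limbs [simp]: "spine (base t) (limbs t) = t"
  by (induction t) auto

lemma limbs_spine [simp]: "limbs (spine a ts) = ts"
  and base_spine [simp]: "base (spine a ts) = a"
  by (induction ts rule: rev_induct) auto

lemma leaves_spine: "leaves (spine a ts) = a # concat (map leaves ts)"
  by (induction ts rule: rev_induct) auto

lemma size_limbs: "r \<in> set (limbs t) \<Longrightarrow> size r < size t"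
  by (induction t) auto

lemma spine_induct [case_names spine]:
  assumes "\<And>a ts. (\<And>t. t \<in> set ts \<Longrightarrow> P t) \<Longrightarrow> P (spine a ts)"
  shows "P t"
proof (induction t rule: measure_induct_rule[where f = size])
  case (less t)
  then show ?case
    using assms[of "limbs t" "base t"] size_limbs by simp
qed

lemma wf_tree_spine:
  "wf_tree (spine a ts) \<longleftrightarrow>
    (\<forall>t \<in> set ts. wf_tree t \<and> a < min_label t) \<and> distinct (a # concat (map leaves ts)) "
proof -
  have "locally_increasing (spine a ts) \<and> min_label (spine a ts) = a \<longleftrightarrow>
      (\<forall>t \<in> set ts. locally_increasing t \<and> a < min_label t)"
    by (induction ts rule: rev_induct) (auto simp: min_def)
  moreover have "min_label (spine a ts) = a" if "locally_increasing (spine a ts)"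
    using that by (induction ts rule: rev_induct) (auto simp: min_def)
  moreover have "distinct (leaves t)" if "distinct (concat (map leaves ts))" "t \<in> set ts" for t
    using that by (metis distinct_concat_iff image_eqI set_map)
  ultimately show ?thesis
    unfolding wf_tree_def leaves_spine by auto
qed

lemma min_label_spine: "wf_tree (spine a ts) \<Longrightarrow> min_label (spine a ts) = a"
  by (induction ts rule: rev_induct) (auto simp: wf_tree_Node min_def)

definition distinct_limbs :: "ltree list \<Rightarrow> bool" where
  "distinct_limbs ts \<longleftrightarrow> distinct (map min_label ts)"

lemma distinct_limbs_if_wf_tree:
  assumes "wf_tree (spine a ts)"
  shows "distinct_limbs ts"
  using assms
proof (induction ts rule: rev_induct)
  case (snoc t ts)
  then have disj: "set (leaves (spine a ts)) \<inter> set (leaves t) = {}"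
    by (simp add: wf_tree_Node)
  then have "min_label t \<noteq> min_label u" if "u \<in> set ts" for u
    using that min_label_in_leaves[of t] min_label_in_leaves[of u]
    unfolding leaves_spine by (auto simp del: min_label_in_leaves)
  then show ?case
    using snoc by (auto simp: distinct_limbs_def wf_tree_Node)
qed (simp add: distinct_limbs_def)

function permute :: "(ltree list \<Rightarrow> ltree list) \<Rightarrow> ltree \<Rightarrow> ltree" where
  "permute \<pi> t = spine (base t) (\<pi> (map (permute \<pi>) (limbs t)))"
  by pat_completeness auto
termination
  by (relation "measure (\<lambda>(\<pi>, t). size t)") (auto dest: size_limbs)

declare permute.simps [simp del]

lemma permute_spine: "permute \<pi> (spine a ts) = spine a (\<pi> (map (permute \<pi>) ts))"
  by (subst permute.simps) simp

text \<open>The demands are limited to siblings with distinct numbers, because the order-reversing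
  map behind \<open>complement\<close> is only available for these.\<close>

definition permutes_limbs :: "(ltree list \<Rightarrow> ltree list) \<Rightarrow> bool" where
  "permutes_limbs \<pi> \<longleftrightarrow> (\<forall>ts. distinct_limbs ts \<longrightarrow> mset (\<pi> ts) = mset ts) \<and>
     inj_on \<pi> {ts. distinct_limbs ts}"

lemma concat_leaves_mset: "mset (concat (map leaves ts)) = \<Sum>\<^sub># (image_mset (\<lambda>t. mset (leaves t)) (mset ts))"
  by (induction ts) auto

lemma distinct_iff_mset: "mset xs = mset ys \<Longrightarrow> distinct xs \<longleftrightarrow> distinct ys"
  by (metis mset_eq_imp_distinct_iff)

text \<open>The number of a sibling and whether it is a leaf are all that the block conditions below
  read, hence these invariants.\<close>

lemma permute_props:
  assumes "permutes_limbs \<pi>" "wf_tree t"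
  shows "wf_tree (permute \<pi> t) \<and> mset (leaves (permute \<pi> t)) = mset (leaves t) \<and>
    min_label (permute \<pi> t) = min_label t \<and> ((\<exists>a. permute \<pi> t = Leaf a) \<longleftrightarrow> (\<exists>a. t = Leaf a))"
  using assms(2)
proof (induction t rule: spine_induct)
  case (spine a ts)
  let ?us = "map (permute \<pi>) ts"
  have wf: "\<forall>t \<in> set ts. wf_tree t" using spine.prems by (simp add: wf_tree_spine)
  with spine.IH have IH: "\<forall>t \<in> set ts. wf_tree (permute \<pi> t) \<and> mset (leaves (permute \<pi> t)) = mset (leaves t) \<and>
    min_label (permute \<pi> t) = min_label t"
    by blast
  have "map min_label ?us = map min_label ts" using IH by simp
  then have "distinct_limbs ?us"
    using distinct_limbs_if_wf_tree[OF spine.prems] unfolding distinct_limbs_def by argo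
  then have ms: "mset (\<pi> ?us) = mset ?us" using assms(1) by (simp add: permutes_limbs_def)
  then have set: "set (\<pi> ?us) = permute \<pi> ` set ts" by (metis set_map set_mset_mset)
  have "image_mset (\<lambda>t. mset (leaves t)) (mset ?us) = image_mset (\<lambda>t. mset (leaves t)) (mset ts)"
    using IH by (auto simp: multiset.map_comp intro!: image_mset_cong)
  then have lv: "mset (concat (map leaves (\<pi> ?us))) = mset (concat (map leaves ts))"
    by (simp only: concat_leaves_mset ms)
  then have "mset (a # concat (map leaves (\<pi> ?us))) = mset (a # concat (map leaves ts))"
    by simp
  from distinct_iff_mset[OF this] have "wf_tree (spine a (\<pi> ?us))"
    using spine.prems IH set unfolding wf_tree_spine by auto
  moreover have "\<pi> ?us = [] \<longleftrightarrow> ts = []"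
    using arg_cong[OF ms, of size] by auto
  moreover have "(\<exists>b. spine a vs = Leaf b) \<longleftrightarrow> vs = []" for vs
    by (cases vs rule: rev_cases) auto
  ultimately show ?case
    using spine.prems lv by (simp add: permute_spine leaves_spine min_label_spine)
qed

lemma distinct_limbs_map_permute:
  assumes "permutes_limbs \<pi>" "wf_tree (spine a ts)"
  shows "distinct_limbs (map (permute \<pi>) ts)"
proof -
  have "min_label (permute \<pi> t) = min_label t" if "t \<in> set ts" for t
    using that permute_props[OF assms(1)] assms(2) unfolding wf_tree_spine by blast
  then have "map min_label (map (permute \<pi>) ts) = map min_label ts"
    by simp
  then show ?thesis
    using distinct_limbs_if_wf_tree[OF assms(2)] unfolding distinct_limbs_def by argo
qed

lemma permute_inject:
  assumes "permutes_limbs \<pi>" "wf_tree t" "wf_tree u" "permute \<pi> t = permute \<pi> u"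
  shows "t = u"
  using assms(2-4)
proof (induction t arbitrary: u rule: spine_induct)
  case (spine a ts)
  obtain b us where u: "u = spine b us" using spine_limbs[of u] by metis
  note wfu = spine.prems(2)[unfolded u]
  have eq: "spine a (\<pi> (map (permute \<pi>) ts)) = spine b (\<pi> (map (permute \<pi>) us))"
    using spine.prems(3) unfolding u permute_spine .
  have "a = b" using arg_cong[OF eq, of base] by simp
  have "\<pi> (map (permute \<pi>) ts) = \<pi> (map (permute \<pi>) us)"
    using arg_cong[OF eq, of limbs] by simp
  moreover have "inj_on \<pi> {ts. distinct_limbs ts}"
    using assms(1) by (simp add: permutes_limbs_def)
  ultimately have *: "map (permute \<pi>) ts = map (permute \<pi>) us"
    using distinct_limbs_map_permute[OF assms(1)] spine.prems(1) wfu by (meson inj_onD mem_Collect_eq)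
  have "list_all2 (=) ts us"
    unfolding list_all2_conv_all_nth
  proof (intro conjI allI impI)
    show len: "length ts = length us" using * by (rule map_eq_imp_length_eq)
    fix i assume i: "i < length ts"
    then have mem: "ts ! i \<in> set ts" "us ! i \<in> set us" using len by simp_all
    have "permute \<pi> (ts ! i) = permute \<pi> (us ! i)"
      using arg_cong[OF *, of "\<lambda>xs. xs ! i"] i len by simp
    moreover have "wf_tree (ts ! i)" "wf_tree (us ! i)"
      using spine.prems(1) wfu mem unfolding wf_tree_spine by blast+
    ultimately show "ts ! i = us ! i"
      by (intro spine.IH[OF mem(1)])
  qed
  then show ?case using u \<open>a = b\<close> by (simp add: list.rel_eq)
qed

(* Reversing or complementing sibling lists acts on a pattern through its consecutive blocks. *)
definition window :: "(ltree list \<Rightarrow> bool) \<Rightarrow> ltree list \<Rightarrow> bool" where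
  "window W ts \<longleftrightarrow> (\<exists>us ws vs. ts = us @ ws @ vs \<and> W ws)"

lemma windowI: "W ws \<Longrightarrow> ts = us @ ws @ vs \<Longrightarrow> window W ts"
  unfolding window_def by blast

lemma windowE:
  assumes "window W ts"
  obtains us ws vs where "ts = us @ ws @ vs" "W ws"
  using assms unfolding window_def by blast

lemma window_rev: "window W (rev ts) \<longleftrightarrow> window (\<lambda>ws. W (rev ws)) ts"
proof
  assume "window W (rev ts)"
  then obtain us ws vs where *: "rev ts = us @ ws @ vs" "W ws" by (rule windowE)
  have "ts = rev vs @ rev ws @ rev us" using arg_cong[OF *(1), of rev] by simp
  then show "window (\<lambda>ws. W (rev ws)) ts"
    by (rule windowI[rotated]) (simp add: *(2))
next
  assume "window (\<lambda>ws. W (rev ws)) ts"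
  then obtain us ws vs where *: "ts = us @ ws @ vs" "W (rev ws)" by (rule windowE)
  show "window W (rev ts)"
    by (rule windowI[of W, OF *(2)]) (simp add: *(1))
qed

lemma window_map: "window W (map f ts) \<longleftrightarrow> window (\<lambda>ws. W (map f ws)) ts"
proof
  assume "window W (map f ts)"
  then obtain us ws vs where *: "map f ts = us @ ws @ vs" "W ws" by (rule windowE)
  obtain us' rs where rs: "ts = us' @ rs" "ws @ vs = map f rs"
    using map_eq_append_conv[THEN iffD1, OF *(1)] by metis
  obtain ws' vs' where "rs = ws' @ vs'" "ws = map f ws'"
    using append_eq_map_conv[THEN iffD1, OF rs(2)] by metis
  then show "window (\<lambda>ws. W (map f ws)) ts"
    using *(2) rs(1) by (intro windowI[of _ ws']) simp_all
next
  assume "window (\<lambda>ws. W (map f ws)) ts"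
  then obtain us ws vs where *: "ts = us @ ws @ vs" "W (map f ws)" by (rule windowE)
  show "window W (map f ts)"
    by (rule windowI[of W, OF *(2)]) (simp add: *(1))
qed

lemma window_cong:
  assumes "\<And>ws. set ws \<subseteq> set ts \<Longrightarrow> W ws \<longleftrightarrow> W' ws"
  shows "window W ts \<longleftrightarrow> window W' ts"
proof -
  have "set ws \<subseteq> set ts" if "ts = us @ ws @ vs" for us ws vs
    using that by auto
  then show ?thesis
    using assms by (metis windowE windowI)
qed

text \<open>From \<open>Node l r\<close> the siblings up to \<open>r\<close> are visible along the
  left spine and the later ones are not, so a local test sees the blocks ending with
  \<open>r\<close>.\<close>

definition at_end :: "(ltree list \<Rightarrow> bool) \<Rightarrow> ltree \<Rightarrow> ltree \<Rightarrow> bool" where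
  "at_end W l r \<longleftrightarrow> (\<exists>us ws. limbs l @ [r] = us @ ws \<and> W ws)"

text \<open>A nonempty block ends at a sibling, and each sibling has its vertex on the spine. The
  empty block has to be excluded, as a leaf has no vertex to report it.\<close>

lemma occ_at_end:
  assumes "\<not> W []"
  shows "occ (at_end W) (spine a ts) \<longleftrightarrow> window W ts \<or> (\<exists>t \<in> set ts. occ (at_end W) t)"
proof (induction ts rule: rev_induct)
  case Nil
  then show ?case using assms by (simp add: window_def)
next
  case (snoc t ts)
  have "window W (ts @ [t]) \<longleftrightarrow> window W ts \<or> (\<exists>us ws. ts @ [t] = us @ ws \<and> W ws)"
  proof
    assume "window W (ts @ [t])"
    then obtain us ws vs where *: "ts @ [t] = us @ ws @ vs" "W ws" by (rule windowE)
    show "window W ts \<or> (\<exists>us ws. ts @ [t] = us @ ws \<and> W ws)"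
    proof (cases vs rule: rev_cases)
      case Nil
      then show ?thesis using * by auto
    next
      case (snoc vs' v)
      then have "ts = us @ ws @ vs'" using *(1) by simp
      then show ?thesis using windowI[of W, OF *(2)] by blast
    qed
  next
    assume "window W ts \<or> (\<exists>us ws. ts @ [t] = us @ ws \<and> W ws)"
    then show "window W (ts @ [t])"
    proof
      assume "window W ts"
      then obtain us ws vs where *: "ts = us @ ws @ vs" "W ws" by (rule windowE)
      show ?thesis by (rule windowI[of W, OF *(2), of _ us "vs @ [t]"]) (simp add: *(1))
    next
      assume "\<exists>us ws. ts @ [t] = us @ ws \<and> W ws"
      then obtain us ws where *: "ts @ [t] = us @ ws" "W ws" by blast
      show ?thesis by (rule windowI[of W, OF *(2), of _ us "[]"]) (simp add: *(1))
    qed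
  qed
  moreover have "occ (at_end W) (spine a (ts @ [t])) \<longleftrightarrow>
      (\<exists>us ws. ts @ [t] = us @ ws \<and> W ws) \<or> occ (at_end W) (spine a ts) \<or> occ (at_end W) t"
    by (simp add: at_end_def)
  ultimately show ?case
    using snoc.IH by auto
qed

text \<open>By \<open>key\<close> the permutations inside the siblings are invisible to
  \<open>W\<close>. What remains is the effect of \<open>\<pi>\<close> on a single list, which is
  \<open>win\<close>.\<close>

lemma occ_permute:
  assumes \<pi>: "permutes_limbs \<pi>" and "wf_tree t" and W: "\<not> W []" "\<not> W' []"
    and key: "\<And>f ws. \<forall>t \<in> set ws. min_label (f t) = min_label t \<and> ((\<exists>a. f t = Leaf a) \<longleftrightarrow> (\<exists>a. t = Leaf a)) \<Longrightarrow>
      W (map f ws) \<longleftrightarrow> W ws"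
    and win: "\<And>ts. distinct_limbs ts \<Longrightarrow> window W' (\<pi> ts) \<longleftrightarrow> window W ts"
  shows "occ (at_end W') (permute \<pi> t) \<longleftrightarrow> occ (at_end W) t"
  using assms(2)
proof (induction t rule: spine_induct)
  case (spine a ts)
  let ?us = "map (permute \<pi>) ts"
  have wf: "\<forall>t \<in> set ts. wf_tree t" using spine.prems by (simp add: wf_tree_spine)
  note props = permute_props[OF \<pi>]
  have "map min_label ?us = map min_label ts" using props wf by simp
  then have dl: "distinct_limbs ?us"
    using distinct_limbs_if_wf_tree[OF spine.prems] unfolding distinct_limbs_def by argo
  then have "mset (\<pi> ?us) = mset ?us" using \<pi> by (simp add: permutes_limbs_def)
  then have set: "set (\<pi> ?us) = permute \<pi> ` set ts" by (metis set_map set_mset_mset)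
  have "window W' (\<pi> ?us) \<longleftrightarrow> window W ?us" using win[OF dl] .
  also have "\<dots> \<longleftrightarrow> window W ts"
    unfolding window_map
  proof (rule window_cong)
    fix ws assume "set ws \<subseteq> set ts"
    then show "W (map (permute \<pi>) ws) \<longleftrightarrow> W ws"
      using props wf by (intro key) blast
  qed
  finally show ?case
    using spine.IH wf set by (simp add: permute_spine occ_at_end[of W, OF W(1)] occ_at_end[of W', OF W(2)])
qed

lemma wilf_equivalentI_permute:
  assumes \<pi>: "permutes_limbs \<pi>" and W: "\<not> W []" "\<not> W' []"
    and key: "\<And>f ws. \<forall>t \<in> set ws. min_label (f t) = min_label t \<and> ((\<exists>a. f t = Leaf a) \<longleftrightarrow> (\<exists>a. t = Leaf a)) \<Longrightarrow>
      W (map f ws) \<longleftrightarrow> W ws"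
    and win: "\<And>ts. distinct_limbs ts \<Longrightarrow> window W' (\<pi> ts) \<longleftrightarrow> window W ts"
    and p: "\<And>t. wf_tree t \<Longrightarrow> avoids t p \<longleftrightarrow> \<not> occ (at_end W) t"
    and q: "\<And>t. wf_tree t \<Longrightarrow> avoids t q \<longleftrightarrow> \<not> occ (at_end W') t"
  shows "wilf_equivalent {p} {q}"
proof (rule wilf_equivalentI)
  fix n
  show "inj_on (permute \<pi>) (trees n)"
    using permute_inject[OF \<pi>] wf_tree_if_trees by (auto intro!: inj_onI)
  show "permute \<pi> ` trees n \<subseteq> trees n"
  proof (rule image_subsetI)
    fix t assume t: "t \<in> trees n"
    show "permute \<pi> t \<in> trees n"
      using permute_props[OF \<pi> wf_tree_if_trees[OF t]] t by (simp add: trees_iff wf_tree_def)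
  qed
  show "avoids t p \<longleftrightarrow> avoids (permute \<pi> t) q" if "t \<in> trees n" for t
    using occ_permute[OF \<pi> _ W key win] p q permute_props[OF \<pi>] wf_tree_if_trees[OF that] by blast
qed

section \<open>Reversal and complement of sibling lists\<close>

lemma permutes_limbs_rev: "permutes_limbs rev"
  by (auto simp: permutes_limbs_def inj_on_def)

definition reverses :: "(ltree \<Rightarrow> ltree) \<Rightarrow> ltree set \<Rightarrow> bool" where
  "reverses h A \<longleftrightarrow> bij_betw h A A \<and>
     (\<forall>x \<in> A. \<forall>y \<in> A. min_label (h x) < min_label (h y) \<longleftrightarrow> min_label y < min_label x)"

lemma ex_reverses:
  assumes "finite A" "inj_on min_label A"
  shows "\<exists>h. reverses h A"
proof -
  let ?k = "card (min_label ` A)"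
  obtain g where g: "bij_betw g {..<?k} (min_label ` A)" and mono: "strict_mono_on {..<?k} g"
    using ex_bij_betw_strict_mono_card assms(1) by (metis finite_imageI)
  have bA: "bij_betw min_label A (min_label ` A)"
    using assms(2) by (simp add: bij_betw_def)
  define e where "e = the_inv_into A min_label \<circ> g"
  have e: "bij_betw e {..<?k} A"
    unfolding e_def using g bij_betw_the_inv_into[OF bA] by (rule bij_betw_trans)
  have min_e: "min_label (e i) = g i" if "i < ?k" for i
  proof -
    have "g i \<in> min_label ` A" using bij_betwE[OF g] that by blast
    then show ?thesis unfolding e_def comp_def by (rule f_the_inv_into_f[OF assms(2)])
  qed
  have less_e: "min_label (e i) < min_label (e j) \<longleftrightarrow> i < j" if "i < ?k" "j < ?k" for i j
    using that strict_mono_on_less[OF mono] by (simp add: min_e)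
  have flip: "bij_betw (\<lambda>i. ?k - 1 - i) {..<?k} {..<?k}"
    by (rule bij_betw_byWitness[where f' = "\<lambda>i. ?k - 1 - i"]) auto
  \<comment> \<open>As \<open>e\<close> lists \<open>A\<close> by increasing number, reflecting the
    positions reverses the order.\<close>
  define h where "h = e \<circ> (\<lambda>i. ?k - 1 - i) \<circ> the_inv_into {..<?k} e"
  have "bij_betw h A A"
    unfolding h_def using bij_betw_trans[OF bij_betw_trans[OF bij_betw_the_inv_into[OF e] flip] e]
    by (simp only: comp_assoc)
  moreover have h_e: "h (e i) = e (?k - 1 - i)" if "i < ?k" for i
    using that e by (simp add: h_def the_inv_into_f_f bij_betw_def)
  have "min_label (h x) < min_label (h y) \<longleftrightarrow> min_label y < min_label x" if "x \<in> A" "y \<in> A" for x y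
  proof -
    have "x \<in> e ` {..<?k}" "y \<in> e ` {..<?k}"
      using that bij_betw_imp_surj_on[OF e] by simp_all
    then obtain i j where "i < ?k" "j < ?k" "x = e i" "y = e j"
      by blast
    then show ?thesis by (auto simp: h_e less_e)
  qed
  ultimately show ?thesis unfolding reverses_def by blast
qed

text \<open>The chosen map depends on the set of siblings and not on their sequence. Complementing
  keeps this set, so lists with equal complements use the same map, and injectivity follows.\<close>

definition complement :: "ltree list \<Rightarrow> ltree list" where
  "complement ts = map (SOME h. reverses h (set ts)) ts"

lemma reverses_some:
  assumes "distinct_limbs ts"
  shows "reverses (SOME h. reverses h (set ts)) (set ts)"
proof (rule someI_ex[OF ex_reverses])
  show "inj_on min_label (set ts)"
    using assms by (simp add: distinct_limbs_def distinct_map)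
qed simp

lemma reversesD:
  assumes "reverses h A"
  shows "inj_on h A" "h ` A = A"
  using assms by (simp_all add: reverses_def bij_betw_def)

lemma complement_props:
  assumes "distinct_limbs ts"
  shows "set (complement ts) = set ts" "distinct (complement ts)" "distinct ts"
proof -
  show "distinct ts"
    using assms by (simp add: distinct_limbs_def distinct_map)
  then show "set (complement ts) = set ts" "distinct (complement ts)"
    using reversesD[OF reverses_some[OF assms]] by (simp_all add: complement_def distinct_map)
qed

lemma permutes_limbs_complement: "permutes_limbs complement"
  unfolding permutes_limbs_def
proof (intro conjI allI impI inj_onI)
  fix ts assume "distinct_limbs ts"
  from complement_props[OF this] show "mset (complement ts) = mset ts"
    using set_eq_iff_mset_eq_distinct by metis
next
  fix ts us
  assume "ts \<in> {ts. distinct_limbs ts}" "us \<in> {ts. distinct_limbs ts}" and eq: "complement ts = complement us"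
  then have d: "distinct_limbs ts" "distinct_limbs us" by simp_all
  have set: "set us = set ts"
    using complement_props(1)[OF d(1)] complement_props(1)[OF d(2)] eq by metis
  have "inj_on (SOME h. reverses h (set ts)) (set ts \<union> set us)"
    unfolding set Un_absorb by (rule reversesD(1)[OF reverses_some[OF d(1)]])
  moreover have "map (SOME h. reverses h (set ts)) ts = map (SOME h. reverses h (set ts)) us"
    using eq unfolding complement_def set .
  ultimately show "ts = us"
    by (simp only: inj_on_map_eq_map)
qed

definition triple :: "(nat \<Rightarrow> nat \<Rightarrow> nat \<Rightarrow> bool) \<Rightarrow> ltree list \<Rightarrow> bool" where
  "triple R ws \<longleftrightarrow>
     (\<exists>x y z. ws = [x, y, z] \<and> R (min_label x) (min_label y) (min_label z))"

lemma triple_Nil: "\<not> triple R []"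
  by (simp add: triple_def)

lemma triple_map:
  assumes "\<forall>t \<in> set ws. min_label (f t) = min_label t \<and> ((\<exists>a. f t = Leaf a) \<longleftrightarrow> (\<exists>a. t = Leaf a))"
  shows "triple R (map f ws) \<longleftrightarrow> triple R ws"
  using assms by (auto simp: triple_def map_eq_Cons_conv)

lemma at_endI: "limbs l @ [r] = us @ ws \<Longrightarrow> W ws \<Longrightarrow> at_end W l r"
  unfolding at_end_def by blast

lemma limbs_eq_snocE:
  assumes "limbs t = us @ [x]"
  obtains w where "t = Node w x" "limbs w = us"
  using assms by (cases t) auto

lemma at_end_pair:
  "at_end (\<lambda>ws. \<exists>x y. ws = [x, y] \<and> P x y) l r \<longleftrightarrow> (\<exists>w x. l = Node w x \<and> P x r)"
    (is "at_end ?W l r \<longleftrightarrow> ?R")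
proof
  assume "at_end ?W l r"
  then obtain us x where "limbs l = us @ [x]" "P x r"
    by (auto simp: at_end_def)
  then show ?R by (auto elim: limbs_eq_snocE)
next
  assume ?R
  then obtain w x where "l = Node w x" "P x r" by blast
  then show "at_end ?W l r"
    by (intro at_endI[of _ _ "limbs w" "[x, r]"]) auto
qed

lemma at_end_triple: "at_left_comb R = at_end (triple R)"
proof (intro ext iffI)
  fix l r
  assume "at_left_comb R l r"
  then obtain w x y where "l = Node (Node w x) y" "R (min_label x) (min_label y) (min_label r)"
    unfolding at_left_comb_iff by blast
  then show "at_end (triple R) l r"
    by (intro at_endI[of _ _ "limbs w" "[x, y, r]"]) (auto simp: triple_def)
next
  fix l r
  assume "at_end (triple R) l r"
  then obtain us x y where *: "limbs l = (us @ [x]) @ [y]" "R (min_label x) (min_label y) (min_label r)"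
    by (auto simp: at_end_def triple_def)
  from *(1) obtain u where "l = Node u y" "limbs u = us @ [x]" by (rule limbs_eq_snocE)
  moreover from this(2) obtain w where "u = Node w x" by (rule limbs_eq_snocE)
  ultimately show "at_left_comb R l r" using *(2) by (simp add: at_left_comb_iff)
qed

text \<open>An occurrence of a left comb is a block of three siblings with prescribed order, so
  reversing the list reverses the arguments of \<open>R\<close>.\<close>

lemma wilf_left_comb_rev:
  assumes "\<And>t. wf_tree t \<Longrightarrow> avoids t p \<longleftrightarrow> \<not> occ (at_left_comb R) t"
    and "\<And>t. wf_tree t \<Longrightarrow> avoids t q \<longleftrightarrow> \<not> occ (at_left_comb (\<lambda>x y z. R z y x)) t"
  shows "wilf_equivalent {p} {q}"
proof (rule wilf_equivalentI_permute[OF permutes_limbs_rev triple_Nil triple_Nil triple_map _ assms[unfolded at_end_triple]])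
  have "triple (\<lambda>x y z. R z y x) (rev ws) \<longleftrightarrow> triple R ws" for ws
    by (auto simp: triple_def rev_eq_Cons_iff)
  then show "window (triple (\<lambda>x y z. R z y x)) (rev ts) \<longleftrightarrow> window (triple R) ts" for ts
    by (simp add: window_rev)
qed

lemma wilf_left_comb_complement: "wilf_equivalent {left_comb 2 4 3} {left_comb 4 2 3}"
proof (rule wilf_equivalentI_permute[OF permutes_limbs_complement triple_Nil triple_Nil triple_map _
      avoids_left_comb_1243[unfolded at_end_triple] avoids_left_comb_1423[unfolded at_end_triple]])
  fix ts assume "distinct_limbs ts"
  let ?h = "SOME h. reverses h (set ts)"
  have h: "min_label (?h x) < min_label (?h y) \<longleftrightarrow> min_label y < min_label x"
    if "x \<in> set ts" "y \<in> set ts" for x y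
    using reverses_some[OF \<open>distinct_limbs ts\<close>] that by (simp add: reverses_def)
  show "window (triple (\<lambda>x y z. y < z \<and> z < x)) (complement ts) \<longleftrightarrow>
      window (triple (\<lambda>x y z. x < z \<and> z < y)) ts"
    unfolding complement_def window_map
    by (rule window_cong) (auto simp: triple_def map_eq_Cons_conv h)
qed

text \<open>The zigzag asks for a sibling with children followed by a smaller one, the fork for a
  sibling with children preceded by a smaller one.\<close>

lemma wilf_left_zigzag_fork: "wilf_equivalent {left_zigzag 3 4 2} {fork 2 3 4}"
proof -
  let ?W = "\<lambda>ws. \<exists>x y. ws = [x, y] \<and> min_label y < min_label x \<and> (\<nexists>a. x = Leaf a)"
  let ?W' = "\<lambda>ws. \<exists>x y. ws = [x, y] \<and> min_label x < min_label y \<and> (\<nexists>a. y = Leaf a)"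
  have W: "at_end ?W l r \<longleftrightarrow> at_left_zigzag (\<lambda>x y z. z < x) l r" if "wf_tree (Node l r)" for l r
    unfolding at_end_pair at_left_zigzag_iff
  proof (cases l)
    case (Node w x)
    then show "(\<exists>w x. l = Node w x \<and> min_label r < min_label x \<and> (\<nexists>a. x = Leaf a)) \<longleftrightarrow>
        (\<exists>w x y. l = Node w (Node x y) \<and> min_label r < min_label x)"
      using that by (cases x) (auto simp: wf_tree_Node min_def)
  qed auto
  have W': "at_end ?W' l r \<longleftrightarrow> at_fork (\<lambda>x y z. x < y) l r" if "wf_tree (Node l r)" for l r
    unfolding at_end_pair at_fork_iff
    using that by (cases r) (auto simp: wf_tree_Node min_def)
  show ?thesis
  proof (rule wilf_equivalentI_permute[OF permutes_limbs_rev, of ?W ?W'])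
    have "?W' (rev ws) \<longleftrightarrow> ?W ws" for ws
      by (auto simp: rev_eq_Cons_iff)
    then show "window ?W' (rev ts) \<longleftrightarrow> window ?W ts" for ts
      by (simp add: window_rev)
    show "avoids t (left_zigzag 3 4 2) \<longleftrightarrow> \<not> occ (at_end ?W) t" if "wf_tree t" for t
      unfolding avoids_left_zigzag_1342[OF that] using occ_cong[OF that, of "at_end ?W" "at_left_zigzag (\<lambda>x y z. z < x)"] W by blast
    show "avoids t (fork 2 3 4) \<longleftrightarrow> \<not> occ (at_end ?W') t" if "wf_tree t" for t
      unfolding avoids_fork_1234[OF that] using occ_cong[OF that, of "at_end ?W'" "at_fork (\<lambda>x y z. x < y)"] W' by blast
  qed (auto simp: map_eq_Cons_conv)
qed

section \<open>The five classes\<close>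

lemma card_trees_Suc_Suc:
  "int (card {t \<in> trees (Suc (Suc n)). A t}) =
    (\<Sum>s\<leftarrow>tern_list n. \<Sum>u\<leftarrow>insert_label (Suc (Suc n)) s. if A (graft (Leaf 1) u) then 1 else 0)"
proof -
  have *: "int (length (filter A (map f xs))) = (\<Sum>u\<leftarrow>xs. if A (f u) then 1 else 0)"
    for f :: "tern \<Rightarrow> ltree" and xs
    by (induction xs) auto
  have **: "(\<Sum>u\<leftarrow>concat (map g xs). f u) = (\<Sum>s\<leftarrow>xs. \<Sum>u\<leftarrow>g s. f u)"
    for f :: "tern \<Rightarrow> int" and g :: "tern \<Rightarrow> tern list" and xs
    by (induction xs) auto
  have "int (card {t \<in> trees (Suc (Suc n)). A t}) =
      (\<Sum>u\<leftarrow>concat (map (insert_label (Suc (Suc n))) (tern_list n)).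
        if A (graft (Leaf 1) u) then 1 else 0)"
    unfolding card_trees_filter * by simp
  also have "\<dots> = (\<Sum>s\<leftarrow>tern_list n. \<Sum>u\<leftarrow>insert_label (Suc (Suc n)) s.
      if A (graft (Leaf 1) u) then 1 else 0)"
    by (rule **)
  finally show ?thesis .
qed

(* The last insertion step is summed separately and in int: code_simp would otherwise carry around
   a list of 945 trees and a unary counter. *)
definition count_without :: "(ltree \<Rightarrow> ltree \<Rightarrow> bool) \<Rightarrow> int" where
  "count_without R = (\<Sum>s\<leftarrow>tern_list 4. \<Sum>u\<leftarrow>insert_label 6 s.
     if \<not> occ R (graft (Leaf 1) u) then 1 else 0)"

lemma card_avoiders_6:
  assumes "\<And>t. wf_tree t \<Longrightarrow> avoids t p \<longleftrightarrow> \<not> occ R t"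
  shows "card (avoiders {p} 6) = nat (count_without R)"
proof -
  have "avoiders {p} 6 = {t \<in> trees (Suc (Suc 4)). \<not> occ R t}"
    unfolding avoiders_def using assms wf_tree_if_trees by auto
  then have "int (card (avoiders {p} 6)) = count_without R"
    using card_trees_Suc_Suc[of 4 "\<lambda>t. \<not> occ R t"] by (simp add: count_without_def)
  then show ?thesis by linarith
qed

text \<open>The evaluation runs over 1*3*5*7*9 = 945 trees, the factors being the numbers of empty
  positions at the successive insertions.\<close>

lemma count_without_left_zigzag_1234: "count_without (at_left_zigzag (\<lambda>x y z. y < z)) = 737"
  by code_simp

lemma count_without_left_comb_1243: "count_without (at_left_comb (\<lambda>x y z. x < z \<and> z < y)) = 738"
  by code_simp

lemma count_without_left_zigzag_1342: "count_without (at_left_zigzag (\<lambda>x y z. z < x)) = 739"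
  by code_simp

lemma count_without_left_zigzag_1243:
  "count_without (at_left_zigzag (\<lambda>x y z. x < z \<and> z < y)) = 740"
  by code_simp

lemma count_without_right_comb_1234: "count_without at_right_comb = 756"
  by code_simp

lemma trees_4:
  "trees 4 = {left_comb 2 3 4, left_comb 2 4 3, left_comb 3 2 4, left_comb 3 4 2,
     left_comb 4 2 3, left_comb 4 3 2, left_zigzag 2 3 4, left_zigzag 2 4 3, left_zigzag 3 4 2,
     fork 2 3 4, fork 3 2 4, fork 4 2 3, right_zigzag 2 3 4, right_zigzag 2 4 3, right_comb 2 3 4}"
proof -
  have "trees 4 = graft (Leaf 1) ` set (tern_list 3)"
    using trees_eq_tern_list[of 3] by simp
  then show ?thesis
    by (simp add: numeral_eq_Suc insert_commute) 
qed

section \<open>Counting the classes\<close>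

text \<open>The classes are the nonempty fibres of \<open>f\<close>, one for each value;
  \<open>f\<close> will be the number of avoiding trees with six leaves.\<close>

lemma card_quotient_kernel:
  assumes "\<And>x y. x \<in> A \<Longrightarrow> y \<in> A \<Longrightarrow> (x, y) \<in> r \<longleftrightarrow> f x = f y"
    and "r \<subseteq> A \<times> A"
  shows "card (A // r) = card (f ` A)"
proof -
  let ?g = "\<lambda>v. {x \<in> A. f x = v}"
  have "A // r = ?g ` f ` A"
  proof -
    have "r `` {x} = ?g (f x)" if "x \<in> A" for x
      using assms that by auto
    then show ?thesis
      unfolding quotient_def image_image by auto
  qed
  moreover have "inj_on ?g (f ` A)"
    by (auto simp: inj_on_def)
  ultimately show ?thesis
    by (simp add: card_image)
qed

lemma wilf_equivalent_sym: "wilf_equivalent P Q \<Longrightarrow> wilf_equivalent Q P"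
  by (simp add: wilf_equivalent_def)

lemma wilf_equivalent_trans:
  "wilf_equivalent P Q \<Longrightarrow> wilf_equivalent Q R \<Longrightarrow> wilf_equivalent P R"
  by (simp add: wilf_equivalent_def)

lemma wilf_equivalent_refl: "wilf_equivalent P P"
  by (simp add: wilf_equivalent_def)

lemma wilf_left_comb_234_432: "wilf_equivalent {left_comb 2 3 4} {left_comb 4 3 2}"
  by (rule wilf_left_comb_rev[OF avoids_left_comb_1234 avoids_left_comb_1432])

lemma wilf_left_comb_243_342: "wilf_equivalent {left_comb 2 4 3} {left_comb 3 4 2}"
  by (rule wilf_left_comb_rev[OF avoids_left_comb_1243 avoids_left_comb_1342])

lemma wilf_left_comb_324_423: "wilf_equivalent {left_comb 3 2 4} {left_comb 4 2 3}"
  by (rule wilf_left_comb_rev[OF avoids_left_comb_1324 avoids_left_comb_1423])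

text \<open>In this order the classes contain 1, 4, 6, 1 and 3 of the fifteen patterns.\<close>

definition representatives :: "ltree set set" where
  "representatives = {{left_zigzag 2 3 4}, {left_comb 2 4 3}, {left_zigzag 3 4 2},
     {left_zigzag 2 4 3}, {right_comb 2 3 4}}"

text \<open>The class of \<open>left_zigzag 3 4 2\<close> is the one that combines reversal,
  \<open>swap\<close> and \<open>rearrange\<close>.\<close>

lemma ex_representative:
  assumes "P \<in> singleton_patterns 4"
  shows "\<exists>R \<in> representatives. wilf_equivalent P R"
proof -
  note s = wilf_equivalent_sym and t = wilf_equivalent_trans
  have right: "wilf_equivalent {right_zigzag 2 4 3} {left_zigzag 3 4 2}"
    by (rule s[OF wilf_left_zigzag_right_zigzag])
  have fork: "wilf_equivalent {fork 4 2 3} {left_zigzag 3 4 2}"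
    by (rule t[OF s[OF wilf_right_zigzag_fork] right])
  have fork': "wilf_equivalent {fork 3 2 4} {left_zigzag 3 4 2}"
    by (rule t[OF wilf_fork_fork fork])
  have "wilf_equivalent {right_zigzag 2 3 4} {left_zigzag 3 4 2}"
    by (rule t[OF wilf_right_zigzag_fork' fork'])
  moreover have "wilf_equivalent {left_comb 2 3 4} {right_comb 2 3 4}"
    by (rule t[OF wilf_left_comb_234_432 wilf_left_comb_right_comb])
  moreover have "wilf_equivalent {left_comb 3 2 4} {left_comb 2 4 3}"
    by (rule t[OF wilf_left_comb_324_423 s[OF wilf_left_comb_complement]])
  moreover note right fork fork' s[OF wilf_left_zigzag_fork] s[OF wilf_left_comb_243_342]
    s[OF wilf_left_comb_complement] wilf_left_comb_right_comb
  ultimately show ?thesis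
    using assms wilf_equivalent_refl unfolding singleton_patterns_def trees_4
    by (auto simp: representatives_def)
qed

lemma card_avoiders_representatives:
  "card (avoiders {left_zigzag 2 3 4} 6) = 737"
  "card (avoiders {left_comb 2 4 3} 6) = 738"
  "card (avoiders {left_zigzag 3 4 2} 6) = 739"
  "card (avoiders {left_zigzag 2 4 3} 6) = 740"
  "card (avoiders {right_comb 2 3 4} 6) = 756"
  using card_avoiders_6[OF avoids_left_zigzag_1234] card_avoiders_6[OF avoids_left_comb_1243]
    card_avoiders_6[OF avoids_left_zigzag_1342] card_avoiders_6[OF avoids_left_zigzag_1243]
    card_avoiders_6[OF avoids_right_comb_1234]
    count_without_left_zigzag_1234 count_without_left_comb_1243 count_without_left_zigzag_1342
    count_without_left_zigzag_1243 count_without_right_comb_1234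
  by simp_all

theorem mainTheorem9:
  shows "card (trees 4) = 15 \<and>
         card (singleton_patterns 4 // wilf_relation_on (singleton_patterns 4)) = 5"
proof
  show "card (trees 4) = 15"
    unfolding trees_4 by simp
  let ?c = "\<lambda>P. card (avoiders P 6)"
  have c: "?c P = ?c Q" if "wilf_equivalent P Q" for P Q
    using that by (simp add: wilf_equivalent_def)
  have img: "?c ` representatives = {737, 738, 739, 740, 756}"
    unfolding representatives_def image_insert image_empty card_avoiders_representatives ..
  \<comment> \<open>At most five representatives take five different counts, so no two of them share
    a count.\<close>
  have "card representatives \<le> 5"
    unfolding representatives_def by (intro card_insert_le_m1) simp_all
  moreover have "card (?c ` representatives) = 5"
    unfolding img by simp
  moreover have "finite representatives"
    by (simp add: representatives_def)
  ultimately have inj: "inj_on ?c representatives"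
    by (metis card_image_le eq_card_imp_inj_on le_antisym)
  have rep_in: "representatives \<subseteq> singleton_patterns 4"
    unfolding representatives_def singleton_patterns_def trees_4 by blast
  \<comment> \<open>Equal counts lead to the same representative, so on the fifteen patterns the
    single count at six leaves decides equivalence.\<close>
  have iff: "wilf_equivalent P Q \<longleftrightarrow> ?c P = ?c Q"
    if "P \<in> singleton_patterns 4" "Q \<in> singleton_patterns 4" for P Q
  proof
    assume eq: "?c P = ?c Q"
    note rep = ex_representative[OF that(1)] ex_representative[OF that(2)]
    obtain R S where RS: "R \<in> representatives" "wilf_equivalent P R"
      "S \<in> representatives" "wilf_equivalent Q S"
      using rep by blast
    have "?c R = ?c S"
      using c[OF RS(2)] c[OF RS(4)] eq by simp
    then have "R = S"
      by (intro inj_onD[OF inj _ RS(1) RS(3)]) simp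
    then show "wilf_equivalent P Q"
      using wilf_equivalent_trans[OF RS(2)] wilf_equivalent_sym[OF RS(4)] by simp
  qed (rule c)
  have "?c ` singleton_patterns 4 = ?c ` representatives"
  proof
    show "?c ` singleton_patterns 4 \<subseteq> ?c ` representatives"
    proof (rule image_subsetI)
      fix P assume "P \<in> singleton_patterns 4"
      then obtain R where "R \<in> representatives" "wilf_equivalent P R"
        using ex_representative by blast
      then show "?c P \<in> ?c ` representatives"
        using c[of P R] by simp
    qed
    show "?c ` representatives \<subseteq> ?c ` singleton_patterns 4"
      by (rule image_mono[OF rep_in])
  qed
  then have "card (?c ` singleton_patterns 4) = 5"
    using img by simp
  moreover have "card (singleton_patterns 4 // wilf_relation_on (singleton_patterns 4)) =
      card (?c ` singleton_patterns 4)"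
    by (rule card_quotient_kernel) (auto simp: wilf_relation_on_def iff)
  ultimately show "card (singleton_patterns 4 // wilf_relation_on (singleton_patterns 4)) = 5"
    by simp
qed

end
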